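(* Let $d\in\mathbb{N}$, $p\in[-\infty,1)$, $q\in\mathbb{N}_0$, let $0\le k_0<\dots<k_q\le d$ be integers and let $K=K_{k_0,\dots,k_q}$ be the selection matrix for which $K^Tc$ is the vector of coefficients $\{c_{k_\ell}^m: m=-k_\ell,\dots,k_\ell;\ \ell=0,\dots,q\}$. Let $r\in\{d+1,\dots,2d\}$ and let $-1\le x_1<\dots<x_r\le1$, $w_1,\dots,w_r>0$ with $\sum w_i=1$ form a quadrature formula of degree $2d$, i.e. $\sum_{i=1}^rw_ix_i^\ell=\frac12\int_{-1}^1x^\ell dx$ for $\ell=0,\dots,2d$. Let $\mu$ be the design on $[0,\pi]$ putting mass $w_i$ at $\theta_i=\arccos x_i$, $i=1,\dots,r$. Let $t\ge 2d+1$ be an integer, $\alpha\in(-\frac{t+1}{t}\pi,-\pi]$, and let $\nu=\nu(\alpha,t)$ be the design on $(-\pi,\pi]$ putting mass $1/t$ at each $\phi_j=\alpha+\frac{2\pi j}{t}$, $j=1,\dots,t$. Then the product design $\mu\otimes\nu$ is $\Phi_p$-optimal for estimating $K^Tc$ in the spherical harmonic regression model of degree $d$, and it is $\Psi_{p,r'}$-optimal in this model for every $r'$ with $1\le r'\le (d+1)^2$.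
   Context: Spherical harmonic functions: for $n\in\mathbb{N}_0$, $Y_n^0(\theta,\phi)=\sqrt{2n+1}\,P_n(\cos\theta)$ with $P_n$ the $n$-th Legendre polynomial; for $1\le m\le n$, $Y_n^m(\theta,\phi)=\sqrt{2(2n+1)\frac{(n-m)!}{(n+m)!}}\,P_n^m(\cos\theta)\cos(m\phi)$ and $Y_n^{-m}(\theta,\phi)=\sqrt{2(2n+1)\frac{(n-m)!}{(n+m)!}}\,P_n^m(\cos\theta)\sin(m\phi)$, where $P_n^m(x)=(-1)^m(1-x^2)^{m/2}\frac{d^m}{dx^m}P_n(x)$; these are orthonormal w.r.t. $\frac{1}{4\pi}\sin\theta\,d\theta\,d\phi$ on $[0,\pi]\times(-\pi,\pi]$. The spherical harmonic regression model of degree $d$ is $E[Y\mid\theta,\phi]=c^Tf_d(\theta,\phi)$, $\mathrm{Var}[Y\mid\theta,\phi]=\sigma^2>0$, with $f_d=(Y_0^0,Y_1^{-1},Y_1^0,Y_1^1,\dots,Y_d^{-d},\dots,Y_d^d)^T\in\mathbb{R}^{(d+1)^2}$ and $c=(c_0^0,c_1^{-1},c_1^0,c_1^1,\dots,c_d^d)^T$. A design is a probability measure $\xi$ on $[0,\pi]\times(-\pi,\pi]$ with information matrix $M(\xi)=\int f_df_d^T\,d\xi$. For $K$ of rank $s$, $K^Tc$ is estimable under $\xi$ if $\mathrm{range}(K)\subset\mathrm{range}(M(\xi))$; then $C_K(\xi)=(K^TM^-(\xi)K)^{-1}$ and $\Phi_p(\xi)=(\mathrm{tr}\,C_K(\xi)^p)^{1/p}$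 ($p\ne0,-\infty$), $\Phi_0(\xi)=\det C_K(\xi)$, $\Phi_{-\infty}(\xi)=\lambda_{\min}(C_K(\xi))$; $\Phi_p$-optimal means maximizing $\Phi_p$ among designs under which $K^Tc$ is estimable. With $\lambda_{(j)}(M(\xi))$ the $j$-th smallest eigenvalue, $\Psi_{p,r'}(\xi)=(\sum_{j=1}^{r'}\lambda_{(j)}(M(\xi))^p)^{1/p}$ ($p\ne0,-\infty$), $\Psi_{0,r'}=\prod_{j=1}^{r'}\lambda_{(j)}$, $\Psi_{-\infty,r'}=\lambda_{(1)}$; $\Psi_{p,r'}$-optimal means maximizing $\Psi_{p,r'}$ over all designs. *)

theory Defs
  imports "HOL-Probability.Probability" "Jordan_Normal_Form.Char_Poly"
begin

text \<open>Legendre polynomial via Rodrigues' formula.\<close>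
definition legendre_poly :: "nat \<Rightarrow> real poly" where
  "legendre_poly n = Polynomial.smult (1 / (2 ^ n * fact n)) ((pderiv ^^ n) ([:-1, 0, 1:] ^ n))"

definition assoc_legendre :: "nat \<Rightarrow> nat \<Rightarrow> real \<Rightarrow> real" where
  "assoc_legendre n m x =
     (-1) ^ m * (1 - x\<^sup>2) powr (real m / 2) * poly ((pderiv ^^ m) (legendre_poly n)) x"

definition sph_harm :: "nat \<Rightarrow> int \<Rightarrow> real \<Rightarrow> real \<Rightarrow> real" where
  "sph_harm n m \<theta> \<phi> =
     (if m = 0 then sqrt (2 * real n + 1) * poly (legendre_poly n) (cos \<theta>)
      else if m > 0 then
        sqrt (2 * (2 * real n + 1) * fact (n - nat m) / fact (n + nat m))
          * assoc_legendre n (nat m) (cos \<theta>) * cos (real (nat m) * \<phi>)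
      else
        sqrt (2 * (2 * real n + 1) * fact (n - nat (-m)) / fact (n + nat (-m)))
          * assoc_legendre n (nat (-m)) (cos \<theta>) * sin (real (nat (-m)) * \<phi>))"

definition sh_index :: "nat \<Rightarrow> (nat \<times> int) list" where
  "sh_index d = concat (map (\<lambda>n. map (\<lambda>m. (n, m)) [- int n..int n]) [0..<Suc d])"

definition regvec :: "nat \<Rightarrow> real \<times> real \<Rightarrow> real list" where
  "regvec d x = map (\<lambda>(n, m). sph_harm n m (fst x) (snd x)) (sh_index d)"

definition design_region :: "(real \<times> real) set" where
  "design_region = {0..pi} \<times> {-pi<..pi}"

definition is_design :: "(real \<times> real) measure \<Rightarrow> bool" where
  "is_design \<xi> \<longleftrightarrow> prob_space \<xi> \<and> sets \<xi> = sets (borel :: (real \<times> real) measure)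
      \<and> emeasure \<xi> design_region = 1"

definition info_mat :: "nat \<Rightarrow> (real \<times> real) measure \<Rightarrow> real mat" where
  "info_mat d \<xi> = mat ((d+1)\<^sup>2) ((d+1)\<^sup>2)
     (\<lambda>(i, j). \<integral>x. regvec d x ! i * regvec d x ! j \<partial>\<xi>)"

definition discrete_design :: "real list \<Rightarrow> real list \<Rightarrow> real measure" where
  "discrete_design pts ws = distr (measure_pmf (pmf_of_list (zip pts ws))) borel (\<lambda>x. x)"

definition sel_positions :: "nat \<Rightarrow> nat set \<Rightarrow> nat list" where
  "sel_positions d ns = filter (\<lambda>j. fst (sh_index d ! j) \<in> ns) [0..<(d+1)\<^sup>2]"

definition selection_mat :: "nat \<Rightarrow> nat set \<Rightarrow> real mat" where
  "selection_mat d ns = mat ((d+1)\<^sup>2) (length (sel_positions d ns))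
     (\<lambda>(i, j). if i = sel_positions d ns ! j then 1 else 0)"

definition estimable :: "real mat \<Rightarrow> real mat \<Rightarrow> bool" where
  "estimable K M \<longleftrightarrow>
     (\<forall>v \<in> carrier_vec (dim_col K). \<exists>u \<in> carrier_vec (dim_col M). K *\<^sub>v v = M *\<^sub>v u)"

definition ginv :: "real mat \<Rightarrow> real mat" where
  "ginv M = (SOME G. G \<in> carrier_mat (dim_col M) (dim_row M) \<and> M * G * M = M)"

definition minv :: "real mat \<Rightarrow> real mat" where
  "minv A = (SOME B. B \<in> carrier_mat (dim_row A) (dim_row A) \<and> A * B = 1\<^sub>m (dim_row A))"

definition C_K :: "real mat \<Rightarrow> real mat \<Rightarrow> real mat" where
  "C_K K M = minv (K\<^sup>T * ginv M * K)"

text \<open>Eigenvalues (with multiplicity) in increasing order, of a matrix whose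
  characteristic polynomial splits over the reals (e.g. a real symmetric one).\<close>
definition sorted_eigs :: "real mat \<Rightarrow> real list" where
  "sorted_eigs A = (THE xs. sorted xs \<and> char_poly A = prod_list (map (\<lambda>x. [:- x, 1:]) xs))"

text \<open>Phi_p of a positive definite matrix C (p in [-inf,1)); for real p \<noteq> 0,
  tr C^p is the sum of the p-th powers of the eigenvalues.\<close>
definition Phi_crit :: "ereal \<Rightarrow> real mat \<Rightarrow> real" where
  "Phi_crit p C =
     (if p = -\<infinity> then hd (sorted_eigs C)
      else if p = 0 then det C
      else sum_list (map (\<lambda>e. e powr real_of_ereal p) (sorted_eigs C)) powr (1 / real_of_ereal p))"

text \<open>Psi_{p,r'} of a nonnegative definite matrix M; for p<0 and singular M the
  value is 0 (limiting convention).\<close>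
definition Psi_crit :: "ereal \<Rightarrow> nat \<Rightarrow> real mat \<Rightarrow> real" where
  "Psi_crit p r' M =
     (let ev = take r' (sorted_eigs M) in
      if p = -\<infinity> then hd ev
      else if p = 0 then prod_list ev
      else if p < 0 \<and> hd ev \<le> 0 then 0
      else sum_list (map (\<lambda>e. e powr real_of_ereal p) (ev)) powr (1 / real_of_ereal p))"

definition Phi_optimal :: "nat \<Rightarrow> ereal \<Rightarrow> real mat \<Rightarrow> (real \<times> real) measure \<Rightarrow> bool" where
  "Phi_optimal d p K \<xi> \<longleftrightarrow>
     is_design \<xi> \<and> estimable K (info_mat d \<xi>) \<and>
     (\<forall>\<eta>. is_design \<eta> \<and> estimable K (info_mat d \<eta>) \<longrightarrow>
        Phi_crit p (C_K K (info_mat d \<eta>)) \<le> Phi_crit p (C_K K (info_mat d \<xi>)))"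

definition Psi_optimal :: "nat \<Rightarrow> ereal \<Rightarrow> nat \<Rightarrow> (real \<times> real) measure \<Rightarrow> bool" where
  "Psi_optimal d p r' \<xi> \<longleftrightarrow>
     is_design \<xi> \<and>
     (\<forall>\<eta>. is_design \<eta> \<longrightarrow> Psi_crit p r' (info_mat d \<eta>) \<le> Psi_crit p r' (info_mat d \<xi>))"

end

theory Submission
  imports Defs "Jordan_Normal_Form.Schur_Decomposition"
begin

text \<open>
  The addition theorem \<open>\<Sum>\<^sub>m Y\<^sub>n\<^sup>m(\<theta>, \<phi>)\<^sup>2 = 2n + 1\<close> makes the diagonal of every information matrix
  sum to \<open>2n + 1\<close> over the block of degree \<open>n\<close>. Hence the eigenvalues of \<open>M(\<xi>)\<close> have mean \<open>1\<close>, and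
  since \<open>C\<^sub>K(\<xi>) \<le> K\<^sup>T M(\<xi>) K\<close> in the Loewner order, those of \<open>C\<^sub>K(\<xi>)\<close> have mean at most \<open>1\<close>.
  The power mean inequality bounds every criterion by its value at the identity matrix. The product
  design attains these bounds because its information matrix is the identity: the \<open>t\<close> equispaced
  points integrate trigonometric polynomials of degree at most \<open>2d < t\<close> exactly, and the remaining
  polar integrands \<open>(1 - x\<^sup>2)\<^sup>m P\<^sub>n\<^sup>(\<^sup>m\<^sup>) P\<^sub>l\<^sup>(\<^sup>m\<^sup>)\<close> are polynomials of degree at most \<open>2d\<close>.
\<close>

text \<open>Competing designs may have singular information matrices, so \<open>C_K\<close> is met
  with an arbitrary generalized inverse. Estimability in the form \<open>K = M * U\<close> removes
  the choice, since the inverse then occurs only inside M M^- M = M. The power mean comparison rests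
  on the tangent of e^p at e = 1: it lies above the power for 0 < p < 1 and below it for p < 0, and
  the outer exponent 1/p turns both cases into the same direction. For the partial spectra in
  \<open>Psi_crit\<close> the extra point is that the smallest entries of a list of mean at most 1
  again have mean at most 1.

  On the product side the azimuthal sum has to act first. If |m| and |m'| differ in parity, the
  polar product contains an odd power of sqrt (1 - x^2), to which a polynomial quadrature does not
  apply. The azimuthal sum kills all pairs with different orders, and also separates m from -m.

  Addition theorem and orthogonality share one source, the equation (x^2 - 1) u' = 2 n x u for u =
  (x^2 - 1)^n.\<close>

unbundle no vec_syntax
unbundle no inner_syntax

subsection \<open>Legendre polynomials\<close>

text \<open>\<open>u\<close> satisfies (x^2 - 1) u' = 2 n x u. Differentiating this once gives the
  case k = 0, and each further derivative passes from k to k + 1.\<close>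

lemma rodrigues_ode:
  fixes n k :: nat
  defines "u \<equiv> [:-1, 0, 1 :: real:] ^ n"
  shows "[:-1, 0, 1:] * (pderiv ^^ (k + 2)) u
       + Polynomial.smult (2 * (real k + 1 - real n)) ([:0, 1:] * (pderiv ^^ (k + 1)) u)
       + Polynomial.smult ((real k + 1) * (real k - 2 * real n)) ((pderiv ^^ k) u) = 0"
    (is "?E k = 0")
proof (induction k)
  case 0
  have first: "[:-1, 0, 1:] * pderiv u = Polynomial.smult (2 * real n) ([:0, 1:] * u)"
  proof (cases n)
    case 0
    then show ?thesis by (simp add: u_def)
  next
    case (Suc j)
    show ?thesis unfolding u_def Suc pderiv_power_Suc
      by (simp add: pderiv_pCons algebra_simps)
  qed
  have "poly (?E 0) x = poly (pderiv ([:-1, 0, 1:] * pderiv u)) x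
      - poly (pderiv (Polynomial.smult (2 * real n) ([:0, 1:] * u))) x" for x
    unfolding pderiv_mult pderiv_smult
    by (simp add: pderiv_mult pderiv_smult pderiv_pCons numeral_2_eq_2 algebra_simps)
  then show ?case
    unfolding first by (simp add: poly_eq_poly_eq_iff[symmetric] fun_eq_iff)
next
  case (Suc k)
  have "poly (?E (Suc k)) x = poly (pderiv (?E k)) x" for x
    unfolding pderiv_add pderiv_mult pderiv_smult
    by (simp add: pderiv_mult pderiv_smult pderiv_pCons pderiv_add numeral_2_eq_2 algebra_simps)
  then show ?case
    unfolding Suc.IH by (simp add: poly_eq_poly_eq_iff[symmetric] fun_eq_iff)
qed

abbreviation legendre_deriv :: "nat \<Rightarrow> nat \<Rightarrow> real poly" where
  "legendre_deriv n m \<equiv> (pderiv ^^ m) (legendre_poly n)"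

lemma legendre_deriv_eq:
  "legendre_deriv n m =
     Polynomial.smult (1 / (2 ^ n * fact n)) ((pderiv ^^ (n + m)) ([:-1, 0, 1:] ^ n))"
  by (simp add: legendre_poly_def higher_pderiv_smult funpow_add add.commute)

text \<open>This is \<open>rodrigues_ode\<close> at order n + m, rescaled by the Rodrigues constant;
  for m = 0 it is Legendre's equation.\<close>

lemma legendre_ode:
  "(1 - x\<^sup>2) * poly (legendre_deriv n (m + 2)) x
     = 2 * (real m + 1) * x * poly (legendre_deriv n (m + 1)) x
       - (real n - real m) * (real n + real m + 1) * poly (legendre_deriv n m) x"
proof -
  define u where "u = [:-1, 0, 1 :: real:] ^ n"
  define c :: real where "c = 1 / (2 ^ n * fact n)"
  have "poly ([:-1, 0, 1:] * (pderiv ^^ (n + m + 2)) u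
       + Polynomial.smult (2 * (real (n + m) + 1 - real n)) ([:0, 1:] * (pderiv ^^ (n + m + 1)) u)
       + Polynomial.smult ((real (n + m) + 1) * (real (n + m) - 2 * real n)) ((pderiv ^^ (n + m)) u)) x = 0"
    unfolding u_def rodrigues_ode by simp
  then have "c * ((x\<^sup>2 - 1) * poly ((pderiv ^^ (n + m + 2)) u) x
       + 2 * (real m + 1) * x * poly ((pderiv ^^ (n + m + 1)) u) x
       + (real n + real m + 1) * (real m - real n) * poly ((pderiv ^^ (n + m)) u) x) = 0"
    by (simp add: power2_eq_square algebra_simps)
  then show ?thesis
    unfolding legendre_deriv_eq u_def[symmetric] c_def[symmetric] add.assoc[symmetric]
    by (simp add: algebra_simps)
qed

lemma degree_legendre_deriv: "Polynomial.degree (legendre_deriv n m) \<le> n - m"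
proof -
  have "Polynomial.degree ([:-1, 0, 1 :: real:] ^ n) \<le> 2 * n"
    using degree_power_le[of "[:-1, 0, 1 :: real:]" n] by simp
  then show ?thesis
    unfolding legendre_deriv_eq
    by (intro order.trans[OF degree_smult_le]) (simp add: degree_higher_pderiv)
qed

text \<open>The truncated bound \<open>n - m\<close> is also 0 at \<open>Suc n\<close> and would
  leave room for a nonzero constant, hence the detour through the constant n-th derivative. This
  makes the last term of a telescoping sum vanish.\<close>

lemma legendre_deriv_Suc_degree: "legendre_deriv n (Suc n) = 0"
proof -
  have "pderiv (legendre_deriv n n) = 0"
    using degree_legendre_deriv[of n n] by (simp add: pderiv_eq_0_iff)
  then show ?thesis by simp
qed

text \<open>At \<open>a\<close> only the Leibniz term survives in which all derivatives fall on the
  power. The induction varies \<open>q\<close> because each derivative changes the cofactor.\<close>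

lemma poly_higher_pderiv_power_mult:
  fixes q :: "real poly"
  shows "poly ((pderiv ^^ k) ([:- a, 1:] ^ k * q)) a = fact k * poly q a"
proof (induction k arbitrary: q)
  case 0
  then show ?case by simp
next
  case (Suc k)
  have "pderiv ([:- a, 1:] ^ Suc k * q)
      = [:- a, 1:] ^ k * (Polynomial.smult (of_nat (Suc k)) q + [:- a, 1:] * pderiv q)"
    by (simp only: pderiv_mult pderiv_power_Suc) (simp add: pderiv_pCons algebra_simps)
  then have "poly ((pderiv ^^ Suc k) ([:- a, 1:] ^ Suc k * q)) a
      = fact k * poly (Polynomial.smult (of_nat (Suc k)) q + [:- a, 1:] * pderiv q) a"
    unfolding funpow_Suc_right comp_def Suc.IH[symmetric] by simp
  then show ?case by (simp add: algebra_simps)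
qed

text \<open>With (x^2 - 1)^n = (x - 1)^n (x + 1)^n the n-th derivative at 1 is n! 2^n, which the
  normalisation cancels.\<close>

lemma legendre_at_1: "poly (legendre_poly n) 1 = 1"
proof -
  have "[:-1, 0, 1 :: real:] = [:- 1, 1:] * [:1, 1:]" by simp
  then have "[:-1, 0, 1 :: real:] ^ n = [:- 1, 1:] ^ n * [:1, 1:] ^ n"
    by (metis power_mult_distrib)
  then show ?thesis
    unfolding legendre_poly_def
    by (simp only: poly_smult poly_higher_pderiv_power_mult) (simp add: poly_power)
qed

text \<open>The product of the associated Legendre functions of degrees n and l. Because the order m
  is shared, the signs cancel and the two half powers of 1 - x^2 combine, so it is a
  polynomial.\<close>

definition legendre_prod :: "nat \<Rightarrow> nat \<Rightarrow> nat \<Rightarrow> real poly" where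
  "legendre_prod n l m = [:1, 0, -1:] ^ m * legendre_deriv n m * legendre_deriv l m"

text \<open>The count is 2 m + (n - m) + (l - m). For n, l at most d this meets the exactness degree
  2 d of the quadrature.\<close>

lemma degree_legendre_prod:
  assumes "m \<le> n" "m \<le> l"
  shows "Polynomial.degree (legendre_prod n l m) \<le> n + l"
proof -
  have "Polynomial.degree ([:1, 0, -1 :: real:] ^ m) \<le> 2 * m"
    using degree_power_le[of "[:1, 0, -1 :: real:]" m] by simp
  moreover have "Polynomial.degree (legendre_prod n l m)
      \<le> Polynomial.degree ([:1, 0, -1 :: real:] ^ m) + Polynomial.degree (legendre_deriv n m)
        + Polynomial.degree (legendre_deriv l m)"
    unfolding legendre_prod_def by (intro order.trans[OF degree_mult_le] add_mono degree_mult_le order.refl)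
  ultimately show ?thesis
    using degree_legendre_deriv[of m n] degree_legendre_deriv[of m l] assms by linarith
qed

lemma pderiv_sq_complement_power:
  "poly (pderiv ([:1, 0, -1 :: real:] ^ Suc m)) x = - 2 * (real m + 1) * x * (1 - x\<^sup>2) ^ m"
  unfolding pderiv_power_Suc by (simp add: pderiv_pCons poly_power power2_eq_square algebra_simps)

text \<open>The self-adjoint form of \<open>legendre_ode\<close>: differentiating the weight
  produces exactly its first-order term.\<close>

lemma legendre_sturm_liouville:
  "poly (pderiv ([:1, 0, -1:] ^ Suc m * legendre_deriv n (Suc m))) x
     = - ((real n - real m) * (real n + real m + 1)) * (1 - x\<^sup>2) ^ m * poly (legendre_deriv n m) x"
proof -
  have "poly (pderiv ([:1, 0, -1:] ^ Suc m * legendre_deriv n (Suc m))) x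
      = (1 - x\<^sup>2) ^ m * ((1 - x\<^sup>2) * poly (legendre_deriv n (m + 2)) x
         - 2 * (real m + 1) * x * poly (legendre_deriv n (m + 1)) x)"
    unfolding pderiv_mult poly_add poly_mult pderiv_sq_complement_power
    by (simp add: poly_power power2_eq_square algebra_simps)
  then show ?thesis unfolding legendre_ode by (simp add: algebra_simps)
qed

text \<open>An integration by parts in disguise. The function differentiated carries the factor (1 -
  x^2)^(m + 1), so it vanishes at both ends of [-1, 1] and the means at orders m and m + 1 become
  proportional.\<close>

lemma pderiv_legendre_prod_shift:
  "pderiv ([:1, 0, -1:] ^ Suc m * legendre_deriv n (Suc m) * legendre_deriv l m)
     = legendre_prod n l (Suc m)
       - Polynomial.smult ((real n - real m) * (real n + real m + 1)) (legendre_prod n l m)"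
  (is "?L = ?R")
proof -
  have "poly ?L x = poly ?R x" for x
    unfolding pderiv_mult[of "_ * _"] poly_add poly_mult legendre_sturm_liouville legendre_prod_def
    by (simp add: poly_power power2_eq_square algebra_simps)
  then show ?thesis by (simp add: poly_eq_poly_eq_iff[symmetric] fun_eq_iff)
qed

lemma fact_diff_Suc_of_nat:
  assumes "m < n"
  shows "fact (n - m) = (real n - real m) * fact (n - Suc m)"
  using assms by (simp add: Suc_diff_Suc[symmetric] of_nat_diff)

text \<open>By the Legendre equation the derivative of this sum telescopes to \<open>0\<close>, so the sum equals
  its value at \<open>1\<close>, where only \<open>P\<^sub>n(1)\<^sup>2\<close> survives.\<close>

lemma legendre_addition:
  "poly (legendre_prod n n 0 + (\<Sum>m<n. Polynomial.smult (2 * fact (n - Suc m) / fact (n + Suc m))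
      (legendre_prod n n (Suc m)))) x = 1"
proof -
  define c :: "nat \<Rightarrow> real" where "c m = 2 * fact (n - m) / fact (n + m)" for m
  define T where "T m = [:1, 0, -1:] ^ m * legendre_deriv n m * legendre_deriv n (Suc m)" for m
  define F where "F = legendre_prod n n 0 + (\<Sum>m<n. Polynomial.smult (c (Suc m)) (legendre_prod n n (Suc m)))"
  \<comment> \<open>The weights are made for this: they absorb the factor in \<open>dQ\<close> and
    leave the previous weight, so neighbouring terms cancel.\<close>
  have c_rec: "c (Suc m) * ((real n - real m) * (real n + real m + 1)) = c m" if "m < n" for m
  proof -
    define a b f g :: real where "a = real n + real m + 1" "b = real n - real m"
        "f = fact (n - Suc m)" "g = fact (n + m)"
      have "2 * f / (a * g) * (b * a) = 2 * (b * f) / g"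
        by (simp add: a_b_f_g_def)
      then show ?thesis
        unfolding c_def fact_diff_Suc_of_nat[OF that] by (simp add: a_b_f_g_def add_ac)
  qed
  have dQ: "poly (pderiv (legendre_prod n n (Suc m))) x
      = poly (T (Suc m)) x - (real n - real m) * (real n + real m + 1) * poly (T m) x" for m x
    unfolding legendre_prod_def pderiv_mult[of "_ * _"] poly_add poly_mult legendre_sturm_liouville T_def
    by (simp add: poly_power power2_eq_square algebra_simps)
  have "poly (pderiv F) x = 0" for x
  proof -
    \<comment> \<open>The term P_n^2 has weight 1, but its derivative is 2 P_n P_n' = 2 T 0, which
      matches c 0 = 2 and closes the telescope at its lower end.\<close>
    have "poly (pderiv F) x = 2 * poly (T 0) x
        + (\<Sum>m<n. c (Suc m) * poly (pderiv (legendre_prod n n (Suc m))) x)"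
      unfolding F_def pderiv_add pderiv_sum poly_add poly_sum pderiv_smult poly_smult
      by (simp add: legendre_prod_def T_def pderiv_mult)
    also have "(\<Sum>m<n. c (Suc m) * poly (pderiv (legendre_prod n n (Suc m))) x)
        = (\<Sum>m<n. c (Suc m) * poly (T (Suc m)) x - c m * poly (T m) x)"
      unfolding dQ by (intro sum.cong refl) (simp add: c_rec[symmetric] algebra_simps)
    also have "\<dots> = c n * poly (T n) x - c 0 * poly (T 0) x"
      by (rule sum_lessThan_telescope)
    also have "poly (T n) x = 0"
      unfolding T_def legendre_deriv_Suc_degree by simp
    finally show ?thesis by (simp add: c_def)
  qed
  then have "pderiv F = 0"
    by (simp add: poly_eq_poly_eq_iff[symmetric] fun_eq_iff)
  then obtain k where k: "F = [:k:]"
    using pderiv_eq_0_iff[of F] degree_eq_zeroE by metis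
  have "poly F 1 = 1"
    unfolding F_def by (simp add: legendre_prod_def poly_sum poly_power legendre_at_1)
  then have "poly F x = 1" using k by simp
  then show ?thesis unfolding F_def c_def .
qed

section \<open>Means over [-1, 1]: orthogonality, norms and quadrature\<close>

definition poly_mean :: "real poly \<Rightarrow> real" where
  "poly_mean p = integral {-1..1} (poly p) / 2"

lemma poly_integrable_on: "poly p integrable_on {a..b :: real}"
  by (intro integrable_continuous_interval continuous_intros)

lemma poly_mean_add: "poly_mean (p + q) = poly_mean p + poly_mean q"
proof -
  have "poly (p + q) = (\<lambda>x. poly p x + poly q x)" by (simp add: fun_eq_iff)
  then show ?thesis
    unfolding poly_mean_def by (simp add: integral_add poly_integrable_on add_divide_distrib)
qed

lemma poly_mean_smult: "poly_mean (Polynomial.smult c p) = c * poly_mean p"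
proof -
  have "poly (Polynomial.smult c p) = (\<lambda>x. c * poly p x)" by (simp add: fun_eq_iff)
  then show ?thesis unfolding poly_mean_def by simp
qed

lemma poly_mean_diff: "poly_mean (p - q) = poly_mean p - poly_mean q"
  using poly_mean_add[of "p - q" q] by simp

lemma poly_mean_sum: "poly_mean (sum f A) = (\<Sum>i\<in>A. poly_mean (f i))"
  using poly_mean_smult[of 0 0]
  by (induction A rule: infinite_finite_induct) (simp_all add: poly_mean_add)

lemma poly_mean_pderiv: "poly_mean (pderiv q) = (poly q 1 - poly q (-1)) / 2"
proof -
  have "(poly (pderiv q) has_integral (poly q 1 - poly q (-1))) {-1..1}"
    by (rule fundamental_theorem_of_calculus)
      (auto intro!: derivative_eq_intros simp: has_real_derivative_iff_has_vector_derivative[symmetric] poly_DERIV)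
  then show ?thesis unfolding poly_mean_def by (simp add: integral_unique)
qed

lemma poly_mean_legendre_prod_Suc:
  "poly_mean (legendre_prod n l (Suc m))
     = (real n - real m) * (real n + real m + 1) * poly_mean (legendre_prod n l m)"
proof -
  have "poly_mean (legendre_prod n l (Suc m)
       - Polynomial.smult ((real n - real m) * (real n + real m + 1)) (legendre_prod n l m)) = 0"
    unfolding pderiv_legendre_prod_shift[symmetric] poly_mean_pderiv
    by (simp add: poly_power)
  then show ?thesis by (simp add: poly_mean_diff poly_mean_smult)
qed

lemma poly_mean_legendre_prod_reduce:
  assumes "m \<le> n"
  shows "poly_mean (legendre_prod n l m) = fact (n + m) / fact (n - m) * poly_mean (legendre_prod n l 0)"
  using assms
proof (induction m)
  case 0
  then show ?case by simp
next
  case (Suc m)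
  then have "m < n" by simp
  with Suc.IH show ?case
    using fact_diff_Suc_of_nat[of m n] unfolding poly_mean_legendre_prod_Suc by simp
qed

lemma legendre_prod_commute: "legendre_prod n l m = legendre_prod l n m"
  by (simp add: legendre_prod_def mult_ac)

text \<open>The mean at order 1 is n (n + 1) times the mean at order 0 and, exchanging n and l, also
  l (l + 1) times it. These factors differ for n \<noteq> l, and all higher orders are multiples of
  order 0.\<close>

lemma poly_mean_legendre_prod_orthogonal:
  assumes "m \<le> n" "n \<noteq> l"
  shows "poly_mean (legendre_prod n l m) = 0"
proof -
  have "(real n * (real n + 1) - real l * (real l + 1)) * poly_mean (legendre_prod n l 0) = 0"
    using poly_mean_legendre_prod_Suc[of n l 0] poly_mean_legendre_prod_Suc[of l n 0]
    by (simp add: legendre_prod_commute[of l n] algebra_simps)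
  moreover have "real n * (real n + 1) - real l * (real l + 1) = (real n - real l) * (real n + real l + 1)"
    by (simp add: algebra_simps)
  ultimately have "poly_mean (legendre_prod n l 0) = 0"
    using assms(2) by auto
  then show ?thesis using poly_mean_legendre_prod_reduce[OF assms(1)] by simp
qed

text \<open>All summands of \<open>legendre_addition\<close> contribute multiples of \<open>\<integral> P\<^sub>n\<^sup>2\<close> to the mean, so
  averaging that identity gives the norm without integrating \<open>(1 - x\<^sup>2)\<^sup>n\<close>.\<close>

lemma poly_mean_legendre_prod_norm:
  assumes "m \<le> n"
  shows "poly_mean (legendre_prod n n m) = fact (n + m) / (fact (n - m) * (2 * real n + 1))"
proof -
  have summand: "2 * fact (n - Suc m) / fact (n + Suc m) * poly_mean (legendre_prod n n (Suc m))
      = 2 * poly_mean (legendre_prod n n 0)" if "m < n" for m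
    using that by (subst poly_mean_legendre_prod_reduce) auto
  have "poly_mean (legendre_prod n n 0 + (\<Sum>m<n. Polynomial.smult (2 * fact (n - Suc m) / fact (n + Suc m))
      (legendre_prod n n (Suc m)))) = 1"
    unfolding poly_mean_def legendre_addition by simp
  then have "poly_mean (legendre_prod n n 0) + (\<Sum>m<n. 2 * poly_mean (legendre_prod n n 0)) = 1"
    unfolding poly_mean_add poly_mean_sum poly_mean_smult using summand by simp
  then have "poly_mean (legendre_prod n n 0) = 1 / (2 * real n + 1)"
    by (simp add: field_simps)
  then show ?thesis unfolding poly_mean_legendre_prod_reduce[OF assms] by simp
qed

lemma quadrature_poly_mean:
  assumes "\<And>l. l \<le> N \<Longrightarrow> (\<Sum>i\<in>I. w i * x i ^ l) = integral {-1..1} (\<lambda>y. y ^ l) / 2"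
    and "Polynomial.degree p \<le> N"
  shows "(\<Sum>i\<in>I. w i * poly p (x i)) = poly_mean p"
proof -
  have p: "poly p y = (\<Sum>l\<le>N. poly.coeff p l * y ^ l)" for y
    unfolding poly_altdef using assms(2)
    by (intro sum.mono_neutral_left) (auto simp: coeff_eq_0)
  have "(\<Sum>i\<in>I. w i * poly p (x i)) = (\<Sum>l\<le>N. poly.coeff p l * (\<Sum>i\<in>I. w i * x i ^ l))"
    unfolding p sum_distrib_left by (subst sum.swap) (simp add: mult_ac)
  also have "\<dots> = (\<Sum>l\<le>N. poly.coeff p l * integral {-1..1} (\<lambda>y. y ^ l)) / 2"
    unfolding sum_divide_distrib by (intro sum.cong) (simp_all add: assms(1))
  also have "\<dots> = poly_mean p"
    unfolding poly_mean_def p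
    by (subst integral_sum) (auto intro!: integrable_continuous_interval continuous_intros)
  finally show ?thesis .
qed

subsection \<open>Spherical harmonics\<close>

text \<open>The squared normalising constant without the extra 2 for m > 0. That 2 moves into
  \<open>azimuthal_part\<close> as sqrt 2, so the polar formulas are uniform in m and every
  azimuthal function has mean square 1.\<close>

definition legendre_norm :: "nat \<Rightarrow> nat \<Rightarrow> real" where
  "legendre_norm n m = (2 * real n + 1) * fact (n - m) / fact (n + m)"

text \<open>The polar factor is written with \<open>sqrt (1 - x\<^sup>2) ^ m\<close> rather than
  \<open>(1 - x\<^sup>2) powr (m / 2)\<close>, because \<open>0 powr 0 = 0\<close> would spoil the case
  \<open>m = 0\<close> at the poles.\<close>

definition polar_part :: "nat \<Rightarrow> nat \<Rightarrow> real \<Rightarrow> real" where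
  "polar_part n m \<theta> = sqrt (legendre_norm n m) * (-1) ^ m * sqrt (1 - (cos \<theta>)\<^sup>2) ^ m
     * poly (legendre_deriv n m) (cos \<theta>)"

definition azimuthal_part :: "int \<Rightarrow> real \<Rightarrow> real" where
  "azimuthal_part m \<phi> =
     (if m = 0 then 1 else if m > 0 then sqrt 2 * cos (of_int m * \<phi>) else sqrt 2 * sin (of_int (- m) * \<phi>))"

lemma one_minus_cos_sq_nonneg: "0 \<le> 1 - (cos (\<theta> :: real))\<^sup>2"
  by (simp add: abs_square_le_1)

lemma sph_harm_factor: "sph_harm n m \<theta> \<phi> = polar_part n (nat \<bar>m\<bar>) \<theta> * azimuthal_part m \<phi>"
proof -
  have norm: "sqrt (2 * (2 * real n + 1) * fact (n - k) / fact (n + k)) = sqrt 2 * sqrt (legendre_norm n k)" for k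
    by (simp add: legendre_norm_def real_sqrt_mult[symmetric])
  have assoc: "assoc_legendre n k (cos \<theta>)
      = (-1) ^ k * sqrt (1 - (cos \<theta>)\<^sup>2) ^ k * poly (legendre_deriv n k) (cos \<theta>)" if "k > 0" for k
  proof -
    have "(1 - (cos \<theta>)\<^sup>2) powr (real k / 2) = sqrt (1 - (cos \<theta>)\<^sup>2) ^ k"
    proof (cases "(cos \<theta>)\<^sup>2 = 1")
      case False
      then have "0 < 1 - (cos \<theta>)\<^sup>2" using one_minus_cos_sq_nonneg[of \<theta>] by simp
      then show ?thesis
        by (simp add: powr_half_sqrt[symmetric] powr_power)
    qed (use that in simp)
    then show ?thesis unfolding assoc_legendre_def by simp
  qed
  consider "m = 0" | "m > 0" | "m < 0" by linarith
  then show ?thesis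
  proof cases
    case 1
    then show ?thesis by (simp add: sph_harm_def polar_part_def azimuthal_part_def legendre_norm_def)
  next
    case 2
    then have "nat \<bar>m\<bar> = nat m" "real (nat m) = of_int m" by simp_all
    with 2 show ?thesis
      using assoc[of "nat m"] unfolding sph_harm_def norm
      by (simp add: polar_part_def azimuthal_part_def)
  next
    case 3
    then have "nat \<bar>m\<bar> = nat (- m)" "real (nat (- m)) = of_int (- m)" by simp_all
    with 3 show ?thesis
      using assoc[of "nat (- m)"] unfolding sph_harm_def norm
      by (simp add: polar_part_def azimuthal_part_def)
  qed
qed

lemma polar_part_mult:
  "polar_part n m \<theta> * polar_part l m \<theta>
     = sqrt (legendre_norm n m) * sqrt (legendre_norm l m) * poly (legendre_prod n l m) (cos \<theta>)"
proof -
  have "sqrt (1 - (cos \<theta>)\<^sup>2) ^ m * sqrt (1 - (cos \<theta>)\<^sup>2) ^ m = (1 - (cos \<theta>)\<^sup>2) ^ m"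
    using one_minus_cos_sq_nonneg[of \<theta>] by (simp add: power_mult_distrib[symmetric])
  moreover have "(-1 :: real) ^ m * (-1) ^ m = 1" by (simp add: power_mult_distrib[symmetric])
  moreover have "polar_part n m \<theta> * polar_part l m \<theta>
     = sqrt (legendre_norm n m) * sqrt (legendre_norm l m) * ((-1) ^ m * (-1) ^ m)
       * (sqrt (1 - (cos \<theta>)\<^sup>2) ^ m * sqrt (1 - (cos \<theta>)\<^sup>2) ^ m)
       * (poly (legendre_deriv n m) (cos \<theta>) * poly (legendre_deriv l m) (cos \<theta>))"
    unfolding polar_part_def by (simp only: mult_ac)
  ultimately show ?thesis
    by (simp add: legendre_prod_def poly_power power2_eq_square)
qed

text \<open>Brings together the orders m and -m, whose azimuthal squares 2 cos^2 and 2 sin^2 add up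
  to a constant.\<close>

lemma sum_symmetric_int:
  fixes f :: "int \<Rightarrow> 'a :: comm_monoid_add"
  shows "(\<Sum>m\<in>{- int n..int n}. f m) = f 0 + (\<Sum>j<n. f (int (Suc j)) + f (- int (Suc j)))"
proof (induction n)
  case (Suc n)
  have "{- int (Suc n)..int (Suc n)} = insert (int (Suc n)) (insert (- int (Suc n)) {- int n..int n})"
    by auto
  then show ?case using Suc by (simp add: add_ac)
qed simp

lemma legendre_norm_nonneg: "0 \<le> legendre_norm n m"
  by (simp add: legendre_norm_def)

text \<open>Pairing m with -m eliminates phi, and what remains is 2 n + 1 times the sum in
  \<open>legendre_addition\<close>.\<close>

lemma sph_harm_addition: "(\<Sum>m\<in>{- int n..int n}. (sph_harm n m \<theta> \<phi>)\<^sup>2) = 2 * real n + 1"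
proof -
  have sq: "(polar_part n m \<theta>)\<^sup>2 = legendre_norm n m * poly (legendre_prod n n m) (cos \<theta>)" for m
    using polar_part_mult[of n m \<theta> n] legendre_norm_nonneg[of n m] by (simp add: power2_eq_square)
  have az: "(azimuthal_part (int (Suc j)) \<phi>)\<^sup>2 + (azimuthal_part (- int (Suc j)) \<phi>)\<^sup>2 = 2" for j
    by (simp add: azimuthal_part_def power_mult_distrib add.commute[of 1 "real j"] sin_squared_eq)
  have pair: "(sph_harm n (int (Suc j)) \<theta> \<phi>)\<^sup>2 + (sph_harm n (- int (Suc j)) \<theta> \<phi>)\<^sup>2
      = 2 * legendre_norm n (Suc j) * poly (legendre_prod n n (Suc j)) (cos \<theta>)" for j
  proof -
    have nat: "nat \<bar>int (Suc j)\<bar> = Suc j" "nat \<bar>- int (Suc j)\<bar> = Suc j" by simp_all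
    have "(sph_harm n (int (Suc j)) \<theta> \<phi>)\<^sup>2 + (sph_harm n (- int (Suc j)) \<theta> \<phi>)\<^sup>2
      = (polar_part n (Suc j) \<theta>)\<^sup>2
        * ((azimuthal_part (int (Suc j)) \<phi>)\<^sup>2 + (azimuthal_part (- int (Suc j)) \<phi>)\<^sup>2)"
      unfolding sph_harm_factor nat power_mult_distrib distrib_left ..
    then show ?thesis unfolding az sq by simp
  qed
  have zero: "(sph_harm n 0 \<theta> \<phi>)\<^sup>2 = (2 * real n + 1) * poly (legendre_prod n n 0) (cos \<theta>)"
    using sq[of 0] by (simp add: sph_harm_factor azimuthal_part_def legendre_norm_def)
  have "(\<Sum>m\<in>{- int n..int n}. (sph_harm n m \<theta> \<phi>)\<^sup>2)
      = (2 * real n + 1) * poly (legendre_prod n n 0) (cos \<theta>)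
        + (\<Sum>j<n. (2 * real n + 1) * (2 * fact (n - Suc j) / fact (n + Suc j)
            * poly (legendre_prod n n (Suc j)) (cos \<theta>)))"
    unfolding sum_symmetric_int pair zero
    by (intro arg_cong2[of _ _ _ _ "(+)"] sum.cong refl) (simp add: legendre_norm_def mult_ac del: fact_Suc)
  also have "\<dots> = (2 * real n + 1) * poly (legendre_prod n n 0 + (\<Sum>m<n. Polynomial.smult
      (2 * fact (n - Suc m) / fact (n + Suc m)) (legendre_prod n n (Suc m)))) (cos \<theta>)"
    unfolding sum_distrib_left[symmetric] distrib_left[symmetric] poly_add poly_sum poly_smult ..
  finally show ?thesis unfolding legendre_addition by simp
qed

text \<open>One square is at most the whole sum over its degree. Being uniform, this bound yields
  integrability under every design.\<close>

lemma sph_harm_sq_le: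
  assumes "\<bar>m\<bar> \<le> int n"
  shows "(sph_harm n m \<theta> \<phi>)\<^sup>2 \<le> 2 * real n + 1"
  unfolding sph_harm_addition[of n \<theta> \<phi>, symmetric]
  using assms by (intro member_le_sum[of m _ "\<lambda>m. (sph_harm n m \<theta> \<phi>)\<^sup>2"]) auto

text \<open>The terms form a geometric progression whose ratio is a t-th root of unity. The ratio
  differs from 1 because t does not divide k.\<close>

lemma sum_cis_equispaced:
  assumes "k \<noteq> 0" "\<bar>k\<bar> < int t"
  shows "(\<Sum>j=1..t. cis (of_int k * (\<alpha> + 2 * pi * real j / real t))) = 0"
proof -
  define \<omega> where "\<omega> = cis (2 * pi * of_int k / real t)"
  have t: "t > 0" using assms by auto
  have pow: "\<omega> ^ j = cis (2 * pi * of_int k * real j / real t)" for j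
  proof -
    have "\<omega> ^ j = cis (real j * (2 * pi * of_int k / real t))"
      unfolding \<omega>_def by (rule Complex.DeMoivre)
    also have "real j * (2 * pi * of_int k / real t) = 2 * pi * of_int k * real j / real t"
      by simp
    finally show ?thesis .
  qed
  have one: "\<omega> ^ t = 1"
    unfolding pow using t by (simp add: cis_multiple_2pi)
  have "\<omega> \<noteq> 1"
  proof
    assume "\<omega> = 1"
    then have "cos (2 * pi * of_int k / real t) = 1"
      unfolding \<omega>_def by (metis cis.sel(1) one_complex.sel(1))
    then obtain i :: int where "2 * pi * of_int k / real t = of_int i * 2 * pi"
      unfolding cos_one_2pi_int by auto
    then have "(of_int k :: real) = of_int i * real t"
      using t by (simp add: field_simps)
    then have "k = i * int t" by (metis of_int_eq_iff of_int_mult of_int_of_nat_eq)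
    then have "int t dvd k" by simp
    then show False using assms zdvd_not_zless[of "\<bar>k\<bar>" "int t"] by auto
  qed
  then have "(\<Sum>j<t. \<omega> ^ j) = 0" using one by (simp add: geometric_sum)
  \<comment> \<open>The points are numbered from 1 to t, so the geometric sum is shifted by one
    factor.\<close>
  then have "\<omega> * (\<Sum>j<t. \<omega> ^ j) = 0" by simp
  then have "(\<Sum>j=1..t. \<omega> ^ j) = 0"
    by (simp add: sum_distrib_left sum.atLeast1_atMost_eq)
  then have "cis (of_int k * \<alpha>) * (\<Sum>j=1..t. \<omega> ^ j) = 0" by simp
  then show ?thesis
    unfolding sum_distrib_left pow cis_mult by (simp add: algebra_simps)
qed

lemma equispaced_mean_cos:
  assumes "\<bar>k\<bar> < int t"
  shows "(\<Sum>j=1..t. 1 / real t * cos (of_int k * (\<alpha> + 2 * pi * real j / real t))) = (if k = 0 then 1 else 0)"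
proof (cases "k = 0")
  case False
  show ?thesis
    using arg_cong[OF sum_cis_equispaced[OF False assms, of \<alpha>], of Re] False
    by (simp add: sum_divide_distrib[symmetric])
qed (use assms in simp)

lemma equispaced_mean_sin:
  assumes "\<bar>k\<bar> < int t"
  shows "(\<Sum>j=1..t. 1 / real t * sin (of_int k * (\<alpha> + 2 * pi * real j / real t))) = 0"
proof (cases "k = 0")
  case False
  show ?thesis
    using arg_cong[OF sum_cis_equispaced[OF False assms, of \<alpha>], of Im] False
    by (simp add: sum_divide_distrib[symmetric])
qed simp

text \<open>Products of sines and cosines become sums with frequencies a - b and a + b. These are at
  most 2 d < t in absolute value, so only frequency 0 survives.\<close>

lemma azimuthal_orthonormal:
  assumes "\<bar>m\<bar> \<le> int d" "\<bar>m'\<bar> \<le> int d" "2 * d + 1 \<le> t"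
  shows "(\<Sum>j=1..t. 1 / real t * (azimuthal_part m (\<alpha> + 2 * pi * real j / real t)
           * azimuthal_part m' (\<alpha> + 2 * pi * real j / real t))) = (if m = m' then 1 else 0)"
proof -
  define \<phi> where "\<phi> j = \<alpha> + 2 * pi * real j / real t" for j
  define E where "E f = (\<Sum>j=1..t. 1 / real t * f (\<phi> j))" for f
  have E_add: "E (\<lambda>x. f x + g x) = E f + E g" and E_diff: "E (\<lambda>x. f x - g x) = E f - E g"
    and E_cmult: "E (\<lambda>x. c * f x) = c * E f" for f g c
    unfolding E_def by (simp_all add: distrib_left right_diff_distrib sum.distrib sum_subtractf
        sum_distrib_left mult_ac)
  have cos: "E (\<lambda>x. cos (of_int k * x)) = (if k = 0 then 1 else 0)"
    and sin: "E (\<lambda>x. sin (of_int k * x)) = 0" if "\<bar>k\<bar> < int t" for k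
    unfolding E_def \<phi>_def using equispaced_mean_cos[OF that] equispaced_mean_sin[OF that] by blast+
  have one: "E (\<lambda>x. 1) = 1" using cos[of 0] assms by simp
  have cc: "E (\<lambda>x. (sqrt 2 * cos (of_int a * x)) * (sqrt 2 * cos (of_int b * x))) = (if a = b then 1 else 0)"
    and ss: "E (\<lambda>x. (sqrt 2 * sin (of_int a * x)) * (sqrt 2 * sin (of_int b * x))) = (if a = b then 1 else 0)"
    and sc: "E (\<lambda>x. (sqrt 2 * sin (of_int a * x)) * (sqrt 2 * cos (of_int b * x))) = 0"
    and cs: "E (\<lambda>x. (sqrt 2 * cos (of_int b * x)) * (sqrt 2 * sin (of_int a * x))) = 0"
    if "0 < a" "0 < b" "a \<le> int d" "b \<le> int d" for a b
  proof -
    have lt: "\<bar>a - b\<bar> < int t" "\<bar>a + b\<bar> < int t" "a + b \<noteq> 0" using that assms(3) by auto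
    have "(sqrt 2 * cos (of_int a * x)) * (sqrt 2 * cos (of_int b * x))
        = cos (of_int (a - b) * x) + cos (of_int (a + b) * x)" for x :: real
      by (simp add: left_diff_distrib distrib_right cos_diff cos_add)
    then show "E (\<lambda>x. (sqrt 2 * cos (of_int a * x)) * (sqrt 2 * cos (of_int b * x))) = (if a = b then 1 else 0)"
      using cos[OF lt(1)] cos[OF lt(2)] lt(3) by (simp only: E_add) auto
    have "(sqrt 2 * sin (of_int a * x)) * (sqrt 2 * sin (of_int b * x))
        = cos (of_int (a - b) * x) - cos (of_int (a + b) * x)" for x :: real
      by (simp add: left_diff_distrib distrib_right cos_diff cos_add)
    then show "E (\<lambda>x. (sqrt 2 * sin (of_int a * x)) * (sqrt 2 * sin (of_int b * x))) = (if a = b then 1 else 0)"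
      using cos[OF lt(1)] cos[OF lt(2)] lt(3) by (simp only: E_diff) auto
    have *: "(sqrt 2 * sin (of_int a * x)) * (sqrt 2 * cos (of_int b * x))
        = sin (of_int (a - b) * x) + sin (of_int (a + b) * x)" for x :: real
      by (simp add: left_diff_distrib distrib_right sin_diff sin_add)
    then show "E (\<lambda>x. (sqrt 2 * sin (of_int a * x)) * (sqrt 2 * cos (of_int b * x))) = 0"
      using sin[OF lt(1)] sin[OF lt(2)] by (simp only: E_add add_0_left)
    have "(sqrt 2 * cos (of_int b * x)) * (sqrt 2 * sin (of_int a * x))
        = sin (of_int (a - b) * x) + sin (of_int (a + b) * x)" for x :: real
      using *[of x] by (simp add: mult_ac)
    then show "E (\<lambda>x. (sqrt 2 * cos (of_int b * x)) * (sqrt 2 * sin (of_int a * x))) = 0"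
      using sin[OF lt(1)] sin[OF lt(2)] by (simp only: E_add add_0_left)
  qed
  have c0: "E (\<lambda>x. sqrt 2 * cos (of_int a * x)) = 0" and s0: "E (\<lambda>x. sqrt 2 * sin (of_int a * x)) = 0"
    if "0 < a" "a \<le> int d" for a
    using cos[of a] sin[of a] that assms(3) by (simp_all add: E_cmult)
  have az0: "azimuthal_part 0 = (\<lambda>x. 1)" by (simp add: azimuthal_part_def fun_eq_iff)
  have azp: "azimuthal_part a = (\<lambda>x. sqrt 2 * cos (of_int a * x))" if "a > 0" for a
    using that by (simp add: azimuthal_part_def fun_eq_iff)
  have azn: "azimuthal_part a = (\<lambda>x. sqrt 2 * sin (of_int (- a) * x))" if "a < 0" for a
    using that by (simp add: azimuthal_part_def fun_eq_iff)
  have "E (\<lambda>x. azimuthal_part m x * azimuthal_part m' x) = (if m = m' then 1 else 0)"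
  proof -
    have pos: "a > 0 \<Longrightarrow> \<bar>a\<bar> \<le> int d \<Longrightarrow> a \<le> int d"
      and neg: "a < 0 \<Longrightarrow> \<bar>a\<bar> \<le> int d \<Longrightarrow> 0 < - a \<and> - a \<le> int d" for a
      by auto
    show ?thesis
    proof (cases m "0 :: int" rule: linorder_cases)
      case m: less
      note nm = neg[OF m assms(1)]
      show ?thesis
      proof (cases m' "0 :: int" rule: linorder_cases)
        case m': less
        then show ?thesis
          unfolding azn[OF m] azn[OF m'] using ss[of "- m" "- m'"] nm neg[OF m' assms(2)] by simp
      next
        case m': equal
        then show ?thesis
          unfolding azn[OF m] m' az0 using s0[of "- m"] nm m by simp
      next
        case m': greater
        then show ?thesis
          unfolding azn[OF m] azp[OF m'] using sc[of "- m" m'] nm pos[OF m' assms(2)] m by simp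
      qed
    next
      case m: equal
      show ?thesis
      proof (cases m' "0 :: int" rule: linorder_cases)
        case m': less
        then show ?thesis
          unfolding azn[OF m'] m az0 using s0[of "- m'"] neg[OF m' assms(2)] by simp
      next
        case m': equal
        then show ?thesis
          unfolding m m' az0 using one by simp
      next
        case m': greater
        then show ?thesis
          unfolding azp[OF m'] m az0 using c0[of m'] pos[OF m' assms(2)] by simp
      qed
    next
      case m: greater
      note pm = pos[OF m assms(1)]
      show ?thesis
      proof (cases m' "0 :: int" rule: linorder_cases)
        case m': less
        then show ?thesis
          unfolding azp[OF m] azn[OF m'] using cs[of "- m'" m] pm neg[OF m' assms(2)] m by simp
      next
        case m': equal
        then show ?thesis
          unfolding azp[OF m] m' az0 using c0[of m] pm m by simp
      next
        case m': greater
        then show ?thesis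
          unfolding azp[OF m] azp[OF m'] using cc[of m m'] pm pos[OF m' assms(2)] m by simp
      qed
    qed
  qed
  then show ?thesis unfolding E_def \<phi>_def .
qed

subsection \<open>Eigenvalues of symmetric matrices\<close>

text \<open>The multiset of roots determines the list up to order. This makes the \<open>THE\<close>
  in \<open>sorted_eigs\<close> well defined.\<close>

lemma linear_factors_sorted_unique:
  fixes xs ys :: "real list"
  assumes "sorted xs" "sorted ys"
    and "(\<Prod>x\<leftarrow>xs. [:- x, 1:]) = (\<Prod>x\<leftarrow>ys. [:- x, 1:])"
  shows "xs = ys"
proof -
  have roots: "proots (\<Prod>x\<leftarrow>zs. [:- x, 1:]) = mset zs" for zs :: "real list"
  proof (induction zs)
    case (Cons z zs)
    have "(\<Prod>x\<leftarrow>zs. [:- x, 1:]) \<noteq> 0"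
      by (auto simp: prod_list_zero_iff)
    then show ?case using Cons by (simp add: proots_mult del: mult_pCons_left)
  qed simp
  show ?thesis
    using assms roots[of xs] roots[of ys] by (metis properties_for_sort sorted_sort_id)
qed

text \<open>The Rayleigh quotient argument: in \<open>a * S = q\<close> the number S is the squared
  norm of the eigenvector and q its Hermitian form, which symmetry makes real.\<close>

lemma symmetric_complex_eigenvalue_real:
  fixes A :: "real mat"
  assumes A: "A \<in> carrier_mat n n" and sym: "A\<^sup>T = A"
    and ev: "eigenvalue (map_mat complex_of_real A) a"
  shows "a \<in> \<real>"
proof -
  let ?A = "map_mat complex_of_real A"
  obtain v where v: "v \<in> carrier_vec n" "v \<noteq> 0\<^sub>v n" "?A *\<^sub>v v = a \<cdot>\<^sub>v v"
    using ev A unfolding eigenvalue_def eigenvector_def by auto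
  define S where "S = (\<Sum>i<n. v $ i * cnj (v $ i))"
  define q where "q = (\<Sum>i<n. \<Sum>j<n. of_real (A $$ (i, j)) * v $ j * cnj (v $ i))"
  have symij: "A $$ (i, j) = A $$ (j, i)" if "i < n" "j < n" for i j
    using sym A that by (metis carrier_matD index_transpose_mat(1))
  have "a * S = q"
  proof -
    have "a * v $ i = (\<Sum>j<n. of_real (A $$ (i, j)) * v $ j)" if "i < n" for i
    proof -
      have "a * v $ i = (?A *\<^sub>v v) $ i" using that v by simp
      also have "\<dots> = (\<Sum>j<n. of_real (A $$ (i, j)) * v $ j)"
        using that A v(1) by (auto simp: scalar_prod_def atLeast0LessThan intro!: sum.cong)
      finally show ?thesis .
    qed
    then show ?thesis
      unfolding S_def q_def sum_distrib_left
      by (intro sum.cong refl) (simp add: mult.assoc[symmetric] sum_distrib_right)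
  qed
  moreover have "cnj q = q"
  proof -
    have "cnj q = (\<Sum>i<n. \<Sum>j<n. of_real (A $$ (j, i)) * cnj (v $ j) * v $ i)"
      unfolding q_def by (simp add: symij)
    also have "\<dots> = q"
      unfolding q_def by (subst sum.swap) (simp add: mult_ac)
    finally show ?thesis .
  qed
  moreover have S: "S = of_real (\<Sum>i<n. (cmod (v $ i))\<^sup>2)"
    unfolding S_def by (simp add: complex_norm_square del: of_real_power)
  moreover have "S \<noteq> 0"
  proof
    assume "S = 0"
    then have "(\<Sum>i<n. (cmod (v $ i))\<^sup>2) = 0" unfolding S using of_real_eq_0_iff by blast
    then have "\<forall>i<n. v $ i = 0" by (simp add: sum_nonneg_eq_0_iff)
    then have "v = 0\<^sub>v n" using v(1) by (intro eq_vecI) auto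
    then show False using v(2) by simp
  qed
  ultimately have "cnj a = a"
    by (metis complex_cnj_complex_of_real complex_cnj_mult mult_right_cancel)
  then show ?thesis by (simp add: Reals_cnj_iff)
qed

lemma of_real_poly_prod_list:
  "map_poly complex_of_real (prod_list ps) = prod_list (map (map_poly complex_of_real) ps)"
proof (induction ps)
  case (Cons p ps)
  have "map_poly complex_of_real (p * q) = map_poly complex_of_real p * map_poly complex_of_real q" for q
    by (intro poly_eqI) (simp add: coeff_map_poly coeff_mult)
  then show ?case using Cons by simp
qed simp

text \<open>Over the complex numbers the polynomial splits, its roots are real, and the
  factorisation descends because the embedding of coefficients is injective.\<close>

lemma symmetric_char_poly_splits:
  fixes A :: "real mat"
  assumes A: "A \<in> carrier_mat n n" and sym: "A\<^sup>T = A"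
  shows "\<exists>es. char_poly A = (\<Prod>e\<leftarrow>es. [:- e, 1:])"
proof -
  let ?A = "map_mat complex_of_real A"
  have cA: "?A \<in> carrier_mat n n" using A by simp
  obtain as where as: "char_poly ?A = (\<Prod>a\<leftarrow>as. [:- a, 1:])"
    using char_poly_factorized[OF cA] by auto
  have "a \<in> \<real>" if "a \<in> set as" for a
  proof -
    have "poly (char_poly ?A) a = 0"
      unfolding as using that by (auto simp: poly_prod_list prod_list_zero_iff)
    then have "eigenvalue ?A a" using eigenvalue_root_char_poly[OF cA] by simp
    then show ?thesis by (rule symmetric_complex_eigenvalue_real[OF A sym])
  qed
  then have as_Re: "as = map complex_of_real (map Re as)"
    by (simp add: map_idI)
  have "map_poly complex_of_real (char_poly A) = char_poly ?A"
    by (rule of_real_hom.char_poly_hom[OF A, symmetric])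
  also have "\<dots> = map_poly complex_of_real (\<Prod>e\<leftarrow>map Re as. [:- e, 1:])"
    unfolding as by (subst as_Re) (simp add: of_real_poly_prod_list comp_def)
  finally have "char_poly A = (\<Prod>e\<leftarrow>map Re as. [:- e, 1:])"
    by (simp add: poly_eq_iff coeff_map_poly)
  then show ?thesis by blast
qed

lemma trace_mult_commute:
  fixes A B :: "'a :: comm_semiring_0 mat"
  assumes "A \<in> carrier_mat n m" "B \<in> carrier_mat m n"
  shows "(\<Sum>i<n. (A * B) $$ (i, i)) = (\<Sum>i<m. (B * A) $$ (i, i))"
proof -
  have "(\<Sum>i<n. (A * B) $$ (i, i)) = (\<Sum>i<n. \<Sum>j<m. A $$ (i, j) * B $$ (j, i))"
    using assms by (auto simp: scalar_prod_def atLeast0LessThan intro!: sum.cong)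
  also have "\<dots> = (\<Sum>j<m. \<Sum>i<n. B $$ (j, i) * A $$ (i, j))"
    by (subst sum.swap) (simp add: mult.commute)
  also have "\<dots> = (\<Sum>i<m. (B * A) $$ (i, i))"
    using assms by (auto simp: scalar_prod_def atLeast0LessThan intro!: sum.cong)
  finally show ?thesis .
qed

lemma sorted_eigs_eqI:
  assumes "sorted xs" "char_poly A = (\<Prod>x\<leftarrow>xs. [:- x, 1:])"
  shows "sorted_eigs A = xs"
  unfolding sorted_eigs_def using assms by (intro the_equality) (auto intro: linear_factors_sorted_unique)

lemma sorted_eigs_one: "sorted_eigs (1\<^sub>m n) = replicate n 1"
proof (rule sorted_eigs_eqI)
  have "diag_mat (1\<^sub>m n :: real mat) = replicate n 1" by simp
  then show "char_poly (1\<^sub>m n :: real mat) = (\<Prod>x\<leftarrow>replicate n 1. [:- x, 1:])"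
    using char_poly_upper_triangular[of "1\<^sub>m n :: real mat" n] by simp
qed simp

text \<open>A Schur decomposition gives a similar triangular matrix with
  \<open>sorted_eigs A\<close> as its diagonal; trace and determinant are invariant under
  similarity.\<close>

lemma symmetric_sorted_eigs:
  fixes A :: "real mat"
  assumes A: "A \<in> carrier_mat n n" and sym: "A\<^sup>T = A"
  shows "sorted (sorted_eigs A)"
    and "char_poly A = (\<Prod>x\<leftarrow>sorted_eigs A. [:- x, 1:])"
    and "length (sorted_eigs A) = n"
    and "sum_list (sorted_eigs A) = (\<Sum>i<n. A $$ (i, i))"
    and "prod_list (sorted_eigs A) = det A"
    and "e \<in> set (sorted_eigs A) \<Longrightarrow> eigenvalue A e"
proof -
  obtain es where es: "char_poly A = (\<Prod>e\<leftarrow>es. [:- e, 1:])"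
    using symmetric_char_poly_splits[OF A sym] by auto
  have "(\<Prod>e\<leftarrow>es. [:- e, 1:]) = (\<Prod>e\<leftarrow>sort es. [:- e, 1:])"
    by (simp add: prod_mset_prod_list[symmetric])
  then have "sorted_eigs A = sort es"
    using es by (intro sorted_eigs_eqI) auto
  then show "sorted (sorted_eigs A)" and split: "char_poly A = (\<Prod>x\<leftarrow>sorted_eigs A. [:- x, 1:])"
    using es \<open>_ = (\<Prod>e\<leftarrow>sort es. [:- e, 1:])\<close> by auto
  obtain B P Q where BPQ: "schur_decomposition A (sorted_eigs A) = (B, P, Q)"
    by (cases "schur_decomposition A (sorted_eigs A)")
  note sch = schur_decomposition[OF A split BPQ]
  have wit: "similar_mat_wit A B P Q" and ut: "upper_triangular B" and diag: "diag_mat B = sorted_eigs A"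
    using sch by auto
  note w = similar_mat_witD2[OF A wit]
  show len: "length (sorted_eigs A) = n"
    unfolding diag[symmetric] using w by (simp add: diag_mat_def)
  have "(\<Sum>i<n. A $$ (i, i)) = (\<Sum>i<n. (P * (B * Q)) $$ (i, i))"
    using w by simp
  also have "\<dots> = (\<Sum>i<n. (B * Q * P) $$ (i, i))"
    by (rule trace_mult_commute) (use w in auto)
  also have "B * Q * P = B" using w by simp
  also have "(\<Sum>i<n. B $$ (i, i)) = sum_list (diag_mat B)"
    using w by (simp add: diag_mat_def interv_sum_list_conv_sum_set_nat atLeast0LessThan)
  finally show "sum_list (sorted_eigs A) = (\<Sum>i<n. A $$ (i, i))" unfolding diag by simp
  have "det A = det B"
    using det_similar[of A B] wit unfolding similar_mat_def by auto
  also have "\<dots> = prod_list (diag_mat B)"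
    by (rule det_upper_triangular[OF ut]) (use w in auto)
  finally show "prod_list (sorted_eigs A) = det A" unfolding diag by simp
  show "eigenvalue A e" if "e \<in> set (sorted_eigs A)"
    using that eigenvalue_root_char_poly[OF A] unfolding split
    by (auto simp: poly_prod_list prod_list_zero_iff)
qed

text \<open>Let R = P A be the row echelon form and H the matrix with a 1 at the transposed pivot
  positions. Then R H is the identity on the nonzero rows of R, so R H R = R, and H P serves for
  A.\<close>

lemma generalized_inverse_exists:
  fixes A :: "'a :: field mat"
  assumes A: "A \<in> carrier_mat nr nc"
  shows "\<exists>G \<in> carrier_mat nc nr. A * G * A = A"
proof -
  note gj = gauss_jordan_single[OF A refl]
  obtain R where R: "R = gauss_jordan_single A" by simp
  obtain P Q where PQ: "R = P * A" "P \<in> carrier_mat nr nr" "Q \<in> carrier_mat nr nr"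
    "P * Q = 1\<^sub>m nr" "Q * P = 1\<^sub>m nr"
    using gj(4) R by auto
  have cR: "R \<in> carrier_mat nr nc" using gj(2) R by simp
  obtain f where f: "pivot_fun R f nc"
    using gj(3) cR unfolding R[symmetric] row_echelon_form_def by auto
  note pf = pivot_funD[OF _ f, of nr]
  \<comment> \<open>A zero row i has f i = nc, which is no row index of H, so column i of H is
    0.\<close>
  define H where "H = mat nc nr (\<lambda>(j, i). if j = f i then 1 else 0 :: 'a)"
  have H: "H \<in> carrier_mat nc nr" unfolding H_def by simp
  have RH: "(R * H) $$ (i, k) = (if f k < nc \<and> i = k then 1 else 0)" if "i < nr" "k < nr" for i k
  proof -
    have "(R * H) $$ (i, k) = (\<Sum>j<nc. R $$ (i, j) * (if j = f k then 1 else 0))"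
      using that cR H unfolding H_def by (auto simp: scalar_prod_def atLeast0LessThan intro!: sum.cong)
    also have "\<dots> = (if f k < nc then R $$ (i, f k) else 0)"
      by (simp add: if_distrib[of "\<lambda>x. _ * x"] sum.delta cong: if_cong)
    also have "\<dots> = (if f k < nc \<and> i = k then 1 else 0)"
      using pf(4,5) that cR by auto
    finally show ?thesis .
  qed
  have RHR: "R * H * R = R"
  proof (rule eq_matI)
    fix i j assume ij: "i < dim_row R" "j < dim_col R"
    then have ij': "i < nr" "j < nc" using cR by auto
    have entry: "(S * R) $$ (i, j) = (\<Sum>k<nr. S $$ (i, k) * R $$ (k, j))"
      if "S \<in> carrier_mat nr nr" for S
      using that ij' cR by (simp add: scalar_prod_def atLeast0LessThan)
    have "(R * H * R) $$ (i, j) = (\<Sum>k<nr. (R * H) $$ (i, k) * R $$ (k, j))"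
      by (rule entry) (use cR H in auto)
    also have "\<dots> = (\<Sum>k<nr. (if k = i then (if f i < nc then R $$ (i, j) else 0) else 0))"
      by (intro sum.cong refl) (use RH ij' in auto)
    also have "\<dots> = (if f i < nc then R $$ (i, j) else 0)"
      using ij' by simp
    also have "\<dots> = R $$ (i, j)"
      using pf(1,2) ij' cR by (metis carrier_matD(1) le_neq_implies_less)
    finally show "(R * H * R) $$ (i, j) = R $$ (i, j)" .
  qed (use cR H in auto)
  have AQR: "A = Q * R"
    unfolding PQ(1) using PQ A by (simp add: assoc_mult_mat[symmetric, of _ nr nr _ nr _ nc])
  have "A * (H * P) * A = Q * (R * H * R)"
  proof -
    have "A * (H * P) * A = Q * R * (H * (P * A))"
      using AQR A H PQ by (simp add: assoc_mult_mat[of _ nr nc _ nr _ nc] assoc_mult_mat[of _ nc nr _ nr _ nc])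
    also have "\<dots> = Q * (R * H * R)"
      unfolding PQ(1)[symmetric] using PQ(3) cR H
      by (simp add: assoc_mult_mat[of _ nr nr _ nc _ nc] assoc_mult_mat[of _ nr nc _ nr _ nc])
    finally show ?thesis .
  qed
  then have "A * (H * P) * A = A" unfolding RHR AQR[symmetric] .
  then show ?thesis using H PQ by (intro bexI[of _ "H * P"]) auto
qed

section \<open>Nonnegative definite matrices\<close>

lemma real_scalar_prod_self:
  fixes v :: "real vec"
  assumes "v \<in> carrier_vec n"
  shows "0 \<le> v \<bullet> v" and "v \<bullet> v = 0 \<longleftrightarrow> v = 0\<^sub>v n"
proof -
  show "0 \<le> v \<bullet> v" by (simp add: scalar_prod_def sum_nonneg)
  show "v \<bullet> v = 0 \<longleftrightarrow> v = 0\<^sub>v n"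
    using assms by (auto simp: scalar_prod_def sum_nonneg_eq_0_iff vec_eq_iff)
qed

text \<open>Symmetry is included, since over the reals it does not follow from the sign of the
  quadratic form.\<close>

definition psd_mat :: "nat \<Rightarrow> real mat \<Rightarrow> bool" where
  "psd_mat n M \<longleftrightarrow> M \<in> carrier_mat n n \<and> M\<^sup>T = M \<and> (\<forall>v \<in> carrier_vec n. 0 \<le> v \<bullet> (M *\<^sub>v v))"

lemma psd_mat_congruence:
  assumes M: "psd_mat n M" and D: "D \<in> carrier_mat n m"
  shows "psd_mat m (D\<^sup>T * M * D)"
proof -
  have cM: "M \<in> carrier_mat n n" and sM: "M\<^sup>T = M" using M by (auto simp: psd_mat_def)
  have "(D\<^sup>T * M * D)\<^sup>T = D\<^sup>T * (D\<^sup>T * M)\<^sup>T"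
    using cM D by (intro transpose_mult) auto
  also have "(D\<^sup>T * M)\<^sup>T = M * D"
    using cM D sM by (subst transpose_mult) auto
  finally have "(D\<^sup>T * M * D)\<^sup>T = D\<^sup>T * M * D"
    using cM D by simp
  moreover have "0 \<le> v \<bullet> (D\<^sup>T * M * D *\<^sub>v v)" if v: "v \<in> carrier_vec m" for v
  proof -
    have "v \<bullet> (D\<^sup>T * M * D *\<^sub>v v) = v \<bullet> (D\<^sup>T *\<^sub>v (M *\<^sub>v (D *\<^sub>v v)))"
      using cM D v by (simp add: assoc_mult_mat_vec[of _ m n _ m] assoc_mult_mat_vec[of _ m n _ n])
    also have "\<dots> = (D *\<^sub>v v) \<bullet> (M *\<^sub>v (D *\<^sub>v v))"
    proof -
      have Dv: "D *\<^sub>v v \<in> carrier_vec n" using D v by auto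
      have y: "M *\<^sub>v (D *\<^sub>v v) \<in> carrier_vec n" using cM D v by auto
      have "D\<^sup>T *\<^sub>v (M *\<^sub>v (D *\<^sub>v v)) \<in> carrier_vec m" by (rule mult_mat_vec_carrier[OF _ y]) (use D in auto)
      then show ?thesis
        using transpose_vec_mult_scalar[OF D v y] comm_scalar_prod[OF v] comm_scalar_prod[OF Dv y] by metis
    qed
    also have "\<dots> \<ge> 0"
      using M D v unfolding psd_mat_def by auto
    finally show ?thesis .
  qed
  ultimately show ?thesis using cM D unfolding psd_mat_def by auto
qed

lemma psd_mat_diag:
  assumes M: "psd_mat n M" and i: "i < n"
  shows "0 \<le> M $$ (i, i)"
proof -
  have "unit_vec n i \<bullet> (M *\<^sub>v unit_vec n i) = M $$ (i, i)"
    using M i unfolding psd_mat_def by auto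
  then show ?thesis using M i unfolding psd_mat_def by (metis unit_vec_carrier)
qed

lemma psd_mat_eigenvalue:
  assumes M: "psd_mat n M" and e: "eigenvalue M e"
  shows "0 \<le> e"
proof -
  obtain v where v: "v \<in> carrier_vec n" "v \<noteq> 0\<^sub>v n" "M *\<^sub>v v = e \<cdot>\<^sub>v v"
    using e M unfolding eigenvalue_def eigenvector_def psd_mat_def by auto
  have "0 \<le> v \<bullet> (M *\<^sub>v v)" using M v unfolding psd_mat_def by auto
  also have "\<dots> = e * (v \<bullet> v)" using v by simp
  finally have "0 \<le> e * (v \<bullet> v)" .
  moreover have "v \<bullet> v > 0"
    using v real_scalar_prod_self[of v n] by auto
  ultimately show ?thesis by (simp add: zero_le_mult_iff)
qed

text \<open>Moving from w in the direction y = M w changes the form to 2 s |y|^2 + s^2 c. If y were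
  nonzero, this would be negative for small negative s.\<close>

lemma psd_mat_null:
  assumes M: "psd_mat n M" and w: "w \<in> carrier_vec n" and z: "w \<bullet> (M *\<^sub>v w) = 0"
  shows "M *\<^sub>v w = 0\<^sub>v n"
proof -
  have cM: "M \<in> carrier_mat n n" and sM: "M\<^sup>T = M" using M by (auto simp: psd_mat_def)
  define y where "y = M *\<^sub>v w"
  have y: "y \<in> carrier_vec n" unfolding y_def using cM w by auto
  define c where "c = y \<bullet> (M *\<^sub>v y)"
  have c: "0 \<le> c" using M y unfolding psd_mat_def c_def by auto
  have quad: "0 \<le> 2 * s * (y \<bullet> y) + s\<^sup>2 * c" for s
  proof -
    have sy: "s \<cdot>\<^sub>v y \<in> carrier_vec n" using y by simp
    have "w \<bullet> (M *\<^sub>v y) = y \<bullet> y"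
      using transpose_vec_mult_scalar[OF cM y w] sM y_def by simp
    then have "(w + s \<cdot>\<^sub>v y) \<bullet> (M *\<^sub>v (w + s \<cdot>\<^sub>v y)) = 2 * s * (y \<bullet> y) + s\<^sup>2 * c"
      using cM w y sy z
      by (simp add: mult_add_distrib_mat_vec[OF cM w sy] mult_mat_vec[OF cM y]
          add_scalar_prod_distrib[of _ n] scalar_prod_add_distrib[of _ n]
          y_def[symmetric] c_def[symmetric] power2_eq_square algebra_simps)
    then show ?thesis using M w sy unfolding psd_mat_def by (metis add_carrier_vec)
  qed
  have "y \<bullet> y = 0"
  proof (rule ccontr)
    assume "y \<bullet> y \<noteq> 0"
    then have b: "0 < y \<bullet> y" using real_scalar_prod_self[OF y] by linarith
    define b where "b = y \<bullet> y"
    \<comment> \<open>Close to the minimiser -b / c; the 1 added to c keeps the quotient meaningful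
      for c = 0.\<close>
    define s where "s = - b / (c + 1)"
    have s: "s * (c + 1) = - b" using c by (simp add: s_def)
    have "0 \<le> (c + 1)\<^sup>2 * (2 * s * b + s\<^sup>2 * c)"
      unfolding b_def by (intro mult_nonneg_nonneg quad) simp
    also have "\<dots> = 2 * (c + 1) * (s * (c + 1)) * b + (s * (c + 1))\<^sup>2 * c"
      by (simp add: power2_eq_square algebra_simps)
    also have "\<dots> = - (b\<^sup>2 * (c + 2))"
      unfolding s by (simp add: power2_eq_square algebra_simps)
    also have "\<dots> < 0"
      using b c unfolding b_def[symmetric] by simp
    finally show False by simp
  qed
  then show ?thesis unfolding y_def[symmetric] using real_scalar_prod_self(2)[OF y] by simp
qed

subsection \<open>The matrix \<open>C_K\<close>\<close>

text \<open>Estimability applied to the unit vectors supplies the columns of U one at a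
  time.\<close>

lemma estimable_factor:
  assumes K: "K \<in> carrier_mat n s" and M: "M \<in> carrier_mat n n" and est: "estimable K M"
  shows "\<exists>U \<in> carrier_mat n s. K = M * U"
proof -
  have "\<exists>u. u \<in> carrier_vec n \<and> K *\<^sub>v unit_vec s j = M *\<^sub>v u" if "j < s" for j
    using est K M unfolding estimable_def by auto
  then obtain u where u: "\<And>j. j < s \<Longrightarrow> u j \<in> carrier_vec n"
    "\<And>j. j < s \<Longrightarrow> K *\<^sub>v unit_vec s j = M *\<^sub>v u j"
    by metis
  define U where "U = mat n s (\<lambda>(i, j). u j $ i)"
  have U: "U \<in> carrier_mat n s" unfolding U_def by simp
  have "K = M * U"
  proof (rule mat_col_eqI)
    fix j assume "j < dim_col (M * U)"
    then have j: "j < s" using U by simp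
    have "col K j = K *\<^sub>v unit_vec s j"
      using K j by (intro eq_vecI) auto
    also have "\<dots> = M *\<^sub>v u j" using u(2) j by simp
    also have "u j = col U j"
      using u(1)[OF j] j unfolding U_def by (intro eq_vecI) auto
    also have "M *\<^sub>v col U j = col (M * U) j"
      using M U j by (intro col_mult2[symmetric]) auto
    finally show "col K j = col (M * U) j" .
  qed (use K M U in auto)
  then show ?thesis using U by auto
qed

lemma minv_right_inverse:
  assumes A: "A \<in> carrier_mat n n" and "det A \<noteq> 0"
  shows "minv A \<in> carrier_mat n n" "A * minv A = 1\<^sub>m n" "minv A * A = 1\<^sub>m n"
proof -
  obtain B where "B \<in> carrier_mat n n" "A * B = 1\<^sub>m n"
    using det_non_zero_imp_unit[OF assms, of "()"] unfolding Units_def ring_mat_def by auto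
  then have "\<exists>B. B \<in> carrier_mat (dim_row A) (dim_row A) \<and> A * B = 1\<^sub>m (dim_row A)"
    using A by auto
  from someI_ex[OF this] show B: "minv A \<in> carrier_mat n n" "A * minv A = 1\<^sub>m n"
    unfolding minv_def using A by auto
  show "minv A * A = 1\<^sub>m n"
    by (rule mat_mult_left_right_inverse[OF A B])
qed

lemma ginv_property:
  assumes "M \<in> carrier_mat n m"
  shows "ginv M \<in> carrier_mat m n" "M * ginv M * M = M"
proof -
  have "\<exists>G. G \<in> carrier_mat (dim_col M) (dim_row M) \<and> M * G * M = M"
    using generalized_inverse_exists[OF assms] assms by auto
  from someI_ex[OF this] show "ginv M \<in> carrier_mat m n" "M * ginv M * M = M"
    unfolding ginv_def using assms by auto
qed

text \<open>With \<open>K = M U\<close> and \<open>C = C_K K M\<close>, the matrix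
  \<open>(K - U C)\<^sup>T M (K - U C) = K\<^sup>T M K - C\<close> is nonnegative definite.\<close>

lemma C_K_psd_bounds:
  assumes M: "psd_mat n M" and K: "K \<in> carrier_mat n s" and orth: "K\<^sup>T * K = 1\<^sub>m s"
    and est: "estimable K M"
  shows "psd_mat s (C_K K M)"
    and "eigenvalue (C_K K M) e \<Longrightarrow> 0 < e"
    and "i < s \<Longrightarrow> C_K K M $$ (i, i) \<le> (K\<^sup>T * M * K) $$ (i, i)"
proof -
  have cM: "M \<in> carrier_mat n n" and sM: "M\<^sup>T = M" using M by (auto simp: psd_mat_def)
  obtain U where U: "U \<in> carrier_mat n s" and KU: "K = M * U"
    using estimable_factor[OF K cM est] by auto
  note G = ginv_property[OF cM]
  have KT: "K\<^sup>T = U\<^sup>T * M"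
    unfolding KU using cM U sM by (simp add: transpose_mult[of _ n n _ s])
  define A where "A = U\<^sup>T * M * U"
  have A: "psd_mat s A" unfolding A_def by (rule psd_mat_congruence[OF M U])
  then have cA: "A \<in> carrier_mat s s" and sA: "A\<^sup>T = A" by (auto simp: psd_mat_def)
  \<comment> \<open>Here the arbitrary choice of the generalized inverse disappears.\<close>
  have "K\<^sup>T * ginv M * K = U\<^sup>T * (M * ginv M * M) * U"
    unfolding KT unfolding KU using cM U G(1)
    by (simp add: assoc_mult_mat[of _ s n _ n _ n] assoc_mult_mat[of _ s n _ n _ s]
        assoc_mult_mat[of _ n n _ n _ n] assoc_mult_mat[of _ n n _ n _ s])
  then have C_def': "C_K K M = minv A"
    unfolding C_K_def A_def G(2) by simp
  \<comment> \<open>A kernel vector v makes the form of M vanish at U v. Then K v = M U v = 0, and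
    K^T K = 1 forces v = 0.\<close>
  have "det A \<noteq> 0"
  proof
    assume "det A = 0"
    then obtain v where v: "v \<in> carrier_vec s" "v \<noteq> 0\<^sub>v s" "A *\<^sub>v v = 0\<^sub>v s"
      using det_0_iff_vec_prod_zero[OF cA] by auto
    define y where "y = U *\<^sub>v v"
    have y: "y \<in> carrier_vec n" unfolding y_def using U v by auto
    have "A *\<^sub>v v = U\<^sup>T *\<^sub>v (M *\<^sub>v y)"
      unfolding A_def y_def using cM U v
      by (simp add: assoc_mult_mat_vec[of _ s n _ s] assoc_mult_mat_vec[of _ s n _ n])
    then have "y \<bullet> (M *\<^sub>v y) = (A *\<^sub>v v) \<bullet> v"
      using transpose_vec_mult_scalar[OF U v(1), of "M *\<^sub>v y"] cM y
        comm_scalar_prod[OF y, of "M *\<^sub>v y"] unfolding y_def by simp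
    then have "y \<bullet> (M *\<^sub>v y) = 0" using v by simp
    then have "M *\<^sub>v y = 0\<^sub>v n" by (rule psd_mat_null[OF M y])
    then have "K *\<^sub>v v = 0\<^sub>v n" unfolding KU y_def using cM U v by simp
    then have "K\<^sup>T *\<^sub>v (K *\<^sub>v v) = 0\<^sub>v s" using K by auto
    then have "v = 0\<^sub>v s"
      using orth K v by (simp add: assoc_mult_mat_vec[symmetric, of _ s n _ s])
    then show False using v by simp
  qed
  note inv = minv_right_inverse[OF cA this, folded C_def']
  define C where "C = C_K K M"
  have cC: "C \<in> carrier_mat s s" and AC: "A * C = 1\<^sub>m s" and CA: "C * A = 1\<^sub>m s"
    using inv unfolding C_def by auto
  have sC: "C\<^sup>T = C"
  proof -
    have "C\<^sup>T * A = 1\<^sub>m s"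
      using arg_cong[OF AC, of transpose_mat] cA cC sA by (simp add: transpose_mult[of _ s s _ s])
    then have "C\<^sup>T * A * C = C" using cC by simp
    then show ?thesis using cA cC AC by (simp add: assoc_mult_mat[of _ s s _ s _ s])
  qed
  have CAC: "C\<^sup>T * A * C = C" unfolding sC CA using cC by simp
  show psd: "psd_mat s (C_K K M)"
    using psd_mat_congruence[OF A cC] unfolding CAC by (simp add: C_def)
  show "0 < e" if e: "eigenvalue (C_K K M) e"
  proof -
    obtain v where v: "v \<in> carrier_vec s" "v \<noteq> 0\<^sub>v s" "C *\<^sub>v v = e \<cdot>\<^sub>v v"
      using e cC unfolding eigenvalue_def eigenvector_def C_def[symmetric] by auto
    have "e \<noteq> 0"
    proof
      assume "e = 0"
      then have "C *\<^sub>v v = 0\<^sub>v s" using v by auto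
      then have "A *\<^sub>v (C *\<^sub>v v) = 0\<^sub>v s" using cA by auto
      then have "v = 0\<^sub>v s"
        using AC cC v assoc_mult_mat_vec[OF cA cC v(1)] by simp
      then show False using v by simp
    qed
    with psd_mat_eigenvalue[OF psd e] show ?thesis by simp
  qed
  show "C_K K M $$ (i, i) \<le> (K\<^sup>T * M * K) $$ (i, i)" if i: "i < s"
  proof -
    define D where "D = K - U * C"
    have D: "D \<in> carrier_mat n s" unfolding D_def using K U cC by auto
    have UC: "U * C \<in> carrier_mat n s" using U cC by auto
    have MUC: "M * (U * C) = K * C" unfolding KU using cM U cC by simp
    have UCM: "(U * C)\<^sup>T * M = C * K\<^sup>T"
      unfolding KT using cM U cC sC
      by (simp add: transpose_mult[of _ n s _ s] assoc_mult_mat[of _ s s _ n _ n])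
    \<comment> \<open>\<open>KK\<close> with \<open>MUC\<close>, then \<open>CKK\<close> and
      \<open>CKUC\<close>: apart from K^T M K, every term in the expansion of D^T M D is C up to
      sign.\<close>
    have KK: "K\<^sup>T * (K * C) = C"
      using K cC orth by (simp add: assoc_mult_mat[symmetric, of _ s n _ s _ s])
    have CKK: "C * K\<^sup>T * K = C"
      using K cC orth by (simp add: assoc_mult_mat[of _ s s _ n _ s])
    have CKUC: "C * K\<^sup>T * (U * C) = C"
    proof -
      have "C * K\<^sup>T * (U * C) = C * (K\<^sup>T * U * C)"
        using K U cC by (simp add: assoc_mult_mat[of _ s s _ n _ s] assoc_mult_mat[of _ s n _ s _ s])
      also have "K\<^sup>T * U = A" unfolding KT A_def ..
      finally show ?thesis using AC cC by simp
    qed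
    have DT: "D\<^sup>T = K\<^sup>T - (U * C)\<^sup>T" unfolding D_def using K UC by (simp add: transpose_minus)
    have "D\<^sup>T * M = K\<^sup>T * M - C * K\<^sup>T"
      unfolding DT UCM[symmetric] by (rule minus_mult_distrib_mat[of _ s n _ _ n]) (use K UC cM in auto)
    moreover have X: "K\<^sup>T * M - C * K\<^sup>T \<in> carrier_mat s n" using K cM cC by auto
    ultimately have "D\<^sup>T * M * D = (K\<^sup>T * M - C * K\<^sup>T) * K - (K\<^sup>T * M - C * K\<^sup>T) * (U * C)"
      using mult_minus_distrib_mat[OF X K UC] unfolding D_def by simp
    also have "(K\<^sup>T * M - C * K\<^sup>T) * K = K\<^sup>T * M * K - C * K\<^sup>T * K"
      by (rule minus_mult_distrib_mat[of _ s n _ _ s]) (use K cM cC in auto)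
    also have "(K\<^sup>T * M - C * K\<^sup>T) * (U * C) = K\<^sup>T * M * (U * C) - C * K\<^sup>T * (U * C)"
      by (rule minus_mult_distrib_mat[of _ s n _ _ s]) (use K cM cC UC in auto)
    also have "K\<^sup>T * M * (U * C) = C"
      using K cM UC KK MUC by (simp add: assoc_mult_mat[of _ s n _ n _ s])
    finally have DMD: "D\<^sup>T * M * D = K\<^sup>T * M * K - C - (C - C)" unfolding CKK CKUC .
    have "0 \<le> (D\<^sup>T * M * D) $$ (i, i)"
      by (rule psd_mat_diag[OF psd_mat_congruence[OF M D] i])
    then show ?thesis
      unfolding DMD C_def[symmetric] using i K cM cC by simp
  qed
qed

subsection \<open>Power means\<close>

text \<open>The tangent at 1 of a concave power, in the form of the weighted arithmetic-geometric
  mean inequality for e and 1.\<close>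

lemma powr_le_linear:
  fixes e p :: real
  assumes "0 \<le> e" "0 < p" "p < 1"
  shows "e powr p \<le> 1 + p * (e - 1)"
proof (cases "e = 0")
  case False
  then show ?thesis
    using Youngs_inequality_0[of p "1 - p" e 1] assms by (simp add: algebra_simps)
qed (use assms in simp)

text \<open>The tangent at 1 of a convex power. It follows from ln e \<le> e - 1, reversed by the
  factor p < 0, and 1 + y \<le> exp y.\<close>

lemma linear_le_powr_neg:
  fixes e p :: real
  assumes "0 < e" "p < 0"
  shows "1 + p * (e - 1) \<le> e powr p"
proof -
  have "p * (e - 1) \<le> p * ln e"
    using assms ln_le_minus_one[of e] by (intro mult_left_mono_neg) auto
  then have "1 + p * (e - 1) \<le> 1 + p * ln e" by simp
  also have "\<dots> \<le> exp (p * ln e)" by (rule exp_ge_add_one_self)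
  finally show ?thesis using assms by (simp add: powr_def)
qed

lemma sum_list_affine:
  fixes p :: real
  shows "(\<Sum>e\<leftarrow>es. 1 + p * (e - 1)) = real (length es) + p * (sum_list es - real (length es))"
  by (induction es) (simp_all add: algebra_simps)

text \<open>Summing the tangent bounds compares the power sum with the length, from below for p < 0
  and from above for p > 0. The outer power is decreasing in the first case and increasing in the
  second.\<close>

lemma power_mean_le:
  fixes es :: "real list" and p :: real
  assumes nonneg: "\<And>e. e \<in> set es \<Longrightarrow> 0 \<le> e" and pos: "p < 0 \<Longrightarrow> \<forall>e\<in>set es. 0 < e"
    and le: "sum_list es \<le> real (length es)" and p: "p < 1" "p \<noteq> 0" and ne: "es \<noteq> []"
  shows "(\<Sum>e\<leftarrow>es. e powr p) powr (1 / p) \<le> real (length es) powr (1 / p)"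
proof (cases "p < 0")
  case True
  have "0 \<le> p * (sum_list es - real (length es))"
    using True le by (intro mult_nonpos_nonpos) auto
  then have "real (length es) \<le> (\<Sum>e\<leftarrow>es. 1 + p * (e - 1))"
    unfolding sum_list_affine by simp
  also have "\<dots> \<le> (\<Sum>e\<leftarrow>es. e powr p)"
    by (intro sum_list_mono linear_le_powr_neg) (use True pos in auto)
  finally show ?thesis
    using True ne by (intro powr_mono2') auto
next
  case False
  then have p0: "0 < p" using p by simp
  have "(\<Sum>e\<leftarrow>es. e powr p) \<le> (\<Sum>e\<leftarrow>es. 1 + p * (e - 1))"
    by (intro sum_list_mono powr_le_linear) (use p p0 nonneg in auto)
  also have "\<dots> \<le> real (length es)"
    unfolding sum_list_affine using p0 le by (simp add: mult_le_0_iff)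
  finally show ?thesis
    using p0 by (intro powr_mono2) (auto intro!: sum_list_nonneg)
qed

text \<open>Multiply e \<le> exp (e - 1) over the list. The induction carries the exponential bound
  because the hypothesis on the sum does not pass to the tail.\<close>

lemma prod_list_le_1:
  fixes es :: "real list"
  assumes "\<And>e. e \<in> set es \<Longrightarrow> 0 \<le> e" "sum_list es \<le> real (length es)"
  shows "prod_list es \<le> 1"
proof -
  have "0 \<le> prod_list es \<and> prod_list es \<le> exp (sum_list es - real (length es))"
    using assms(1)
  proof (induction es)
    case (Cons e es)
    have "e \<le> exp (e - 1)" using exp_ge_add_one_self[of "e - 1"] by simp
    then have "e * prod_list es \<le> exp (e - 1) * exp (sum_list es - real (length es))"
      using Cons by (intro mult_mono) auto
    then show ?case using Cons by (simp add: exp_add[symmetric] algebra_simps)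
  qed simp
  moreover have "exp (sum_list es - real (length es)) \<le> 1" using assms(2) by simp
  ultimately show ?thesis by (meson order_trans)
qed

lemma sorted_hd_le_1:
  fixes es :: "real list"
  assumes "sorted es" "es \<noteq> []" "sum_list es \<le> real (length es)"
  shows "hd es \<le> 1"
proof -
  have "(\<Sum>e\<leftarrow>es. hd es) \<le> (\<Sum>e\<leftarrow>es. e)"
    using assms(1,2) by (intro sum_list_mono) (cases es, auto)
  then have "real (length es) * hd es \<le> real (length es) * 1"
    using assms(3) by (simp add: sum_list_triv)
  then show ?thesis using assms(2) by (simp add: mult_le_cancel_left)
qed

text \<open>If the first r entries exceed r in sum, one of them exceeds 1, hence so do all later
  ones, and the total exceeds the length.\<close>

lemma sum_list_take_sorted_le:
  fixes es :: "real list"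
  assumes "sorted es" "sum_list es \<le> real (length es)" "r \<le> length es"
  shows "sum_list (take r es) \<le> real r"
proof (rule ccontr)
  assume neg: "\<not> sum_list (take r es) \<le> real r"
  have split: "sum_list es = sum_list (take r es) + sum_list (drop r es)"
    by (metis append_take_drop_id sum_list_append)
  have "\<exists>a \<in> set (take r es). 1 < a"
  proof (rule ccontr)
    assume "\<not> (\<exists>a \<in> set (take r es). 1 < a)"
    then have "(\<Sum>e\<leftarrow>take r es. e) \<le> (\<Sum>e\<leftarrow>take r es. 1)"
      by (intro sum_list_mono) auto
    then show False using neg assms(3) by (simp add: sum_list_triv)
  qed
  then obtain a where a: "a \<in> set (take r es)" "1 < a" by auto
  have "sorted (take r es @ drop r es)" using assms(1) by simp
  then have "1 \<le> e" if "e \<in> set (drop r es)" for e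
    using that a unfolding sorted_append by fastforce
  then have "(\<Sum>e\<leftarrow>drop r es. 1) \<le> (\<Sum>e\<leftarrow>drop r es. e)"
    by (intro sum_list_mono) auto
  then show False
    using neg split assms(2,3) by (simp add: sum_list_triv)
qed

text \<open>The common form of both criteria on a list of eigenvalues; on a positive spectrum it
  agrees with \<open>Phi_crit\<close>. For p < 0 the zero branch is essential:
  \<open>0 powr p = 0\<close> would silently drop vanishing eigenvalues from the sum.\<close>

definition mean_crit :: "ereal \<Rightarrow> real list \<Rightarrow> real" where
  "mean_crit p es =
     (if p = -\<infinity> then hd es
      else if p = 0 then prod_list es
      else if p < 0 \<and> hd es \<le> 0 then 0
      else sum_list (map (\<lambda>e. e powr real_of_ereal p) es) powr (1 / real_of_ereal p))"

lemma mean_crit_le_ones: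
  assumes "p < 1" "sorted es" "es \<noteq> []" "\<And>e. e \<in> set es \<Longrightarrow> 0 \<le> e"
    and "sum_list es \<le> real (length es)"
  shows "mean_crit p es \<le> mean_crit p (replicate (length es) 1)"
proof -
  have hd1: "hd (replicate (length es) (1::real)) = 1" using assms(3) by (cases es) auto
  consider "p = -\<infinity>" | "p = 0" | "p < 0" "hd es \<le> 0"
    | q where "p = ereal q" "q \<noteq> 0" "q < 1" "q < 0 \<Longrightarrow> 0 < hd es"
  proof (cases p)
    case (real q)
    then show thesis
      using assms(1) that by (cases "q = 0"; cases "q < 0"; cases "hd es \<le> 0") auto
  qed (use assms(1) that in auto)
  then show ?thesis
  proof cases
    case 1
    then show ?thesis using sorted_hd_le_1[OF assms(2,3,5)] hd1 by (simp add: mean_crit_def)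
  next
    case 2
    then show ?thesis using prod_list_le_1[OF assms(4,5)] by (simp add: mean_crit_def)
  next
    case 3
    then show ?thesis
      using hd1 sorted_hd_le_1[OF assms(2,3,5)] by (auto simp: mean_crit_def)
  next
    case (4 q)
    have pos: "\<forall>e\<in>set es. 0 < e" if "q < 0"
      using 4(4)[OF that] assms(2,3) by (cases es) auto
    have "(\<Sum>e\<leftarrow>es. e powr q) powr (1 / q) \<le> real (length es) powr (1 / q)"
      using assms 4 pos by (intro power_mean_le) auto
    then show ?thesis
      using 4 hd1 by (auto simp: mean_crit_def sum_list_replicate)
  qed
qed

subsection \<open>Information matrices of designs\<close>

lemma integrable_discrete_design:
  assumes wf: "pmf_of_list_wf (zip pts ws)" and f: "f \<in> borel_measurable borel"
  shows "integrable (discrete_design pts ws) (f :: real \<Rightarrow> real)"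
  unfolding discrete_design_def
  using f finite_set_pmf_of_list[OF wf]
  by (subst integrable_distr_eq) (auto intro: integrable_measure_pmf_finite)

lemma integral_discrete_design:
  assumes wf: "pmf_of_list_wf (zip pts ws)" and f: "f \<in> borel_measurable borel"
  shows "(\<integral>x. f x \<partial>discrete_design pts ws) = (\<Sum>(x, w)\<leftarrow>zip pts ws. w * f x :: real)"
proof -
  have "(\<integral>x. f x \<partial>discrete_design pts ws) = measure_pmf.expectation (pmf_of_list (zip pts ws)) f"
    unfolding discrete_design_def using f by (subst integral_distr) auto
  also have "\<dots> = (\<Sum>x\<in>set (map fst (zip pts ws)). f x * pmf (pmf_of_list (zip pts ws)) x)"
    using set_pmf_of_list[OF wf] by (intro integral_measure_pmf_real) auto
  also have "\<dots> = (\<Sum>(x, w)\<leftarrow>zip pts ws. w * f x)"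
  proof -
    \<comment> \<open>Points may repeat, in which case their weights add up. The set
      \<open>A\<close> is only required to contain the points, so that it can stay fixed while the
      list shrinks.\<close>
    have "(\<Sum>x\<in>A. f x * sum_list (map snd (filter (\<lambda>z. fst z = x) zs))) = (\<Sum>(x, w)\<leftarrow>zs. w * f x)"
      if "finite A" "fst ` set zs \<subseteq> A" for A and zs :: "(real \<times> real) list"
      using that
    proof (induction zs)
      case (Cons z zs)
      have "(\<Sum>x\<in>A. f x * sum_list (map snd (filter (\<lambda>u. fst u = x) (z # zs))))
          = (\<Sum>x\<in>A. (if fst z = x then f x * snd z else 0)
              + f x * sum_list (map snd (filter (\<lambda>u. fst u = x) zs)))"
        by (intro sum.cong) (auto simp: algebra_simps)
      also have "\<dots> = f (fst z) * snd z + (\<Sum>(x, w)\<leftarrow>zs. w * f x)"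
        using Cons by (simp add: sum.distrib)
      finally show ?case by (simp add: case_prod_unfold mult.commute)
    qed simp
    then show ?thesis
      unfolding pmf_pmf_of_list[OF wf] by simp
  qed
  finally show ?thesis .
qed

lemma prob_space_discrete_design: "prob_space (discrete_design pts ws)"
  unfolding discrete_design_def by (intro measure_pmf.prob_space_distr) simp

lemma sets_discrete_design [measurable_cong]: "sets (discrete_design pts ws) = sets borel"
  by (simp add: discrete_design_def)

lemma emeasure_discrete_design_eq_1:
  assumes wf: "pmf_of_list_wf (zip pts ws)" and A: "A \<in> sets borel" "set pts \<subseteq> A"
  shows "emeasure (discrete_design pts ws) A = 1"
proof -
  have "emeasure (discrete_design pts ws) A = emeasure (measure_pmf (pmf_of_list (zip pts ws))) A"
    unfolding discrete_design_def using A by (subst emeasure_distr) auto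
  also have "\<dots> = 1"
  proof (rule measure_pmf.emeasure_eq_1_AE)
    have "set_pmf (pmf_of_list (zip pts ws)) \<subseteq> A"
    proof -
      have "set (map fst (zip pts ws)) \<subseteq> set pts" by (auto dest: set_zip_leftD)
      then show ?thesis using set_pmf_of_list[OF wf] A(2) by blast
    qed
    then show "AE x in measure_pmf (pmf_of_list (zip pts ws)). x \<in> A"
      by (auto simp: AE_measure_pmf_iff)
  qed simp
  finally show ?thesis .
qed

lemma integral_product_design:
  fixes f g :: "real \<Rightarrow> real"
  assumes "pmf_of_list_wf (zip pts ws)" "pmf_of_list_wf (zip pts' ws')"
    and f[measurable]: "f \<in> borel_measurable borel" and g[measurable]: "g \<in> borel_measurable borel"
  shows "(\<integral>x. f (fst x) * g (snd x) \<partial>(discrete_design pts ws \<Otimes>\<^sub>M discrete_design pts' ws'))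
       = (\<integral>x. f x \<partial>discrete_design pts ws) * (\<integral>x. g x \<partial>discrete_design pts' ws')"
proof -
  let ?\<mu> = "discrete_design pts ws" and ?\<nu> = "discrete_design pts' ws'"
  interpret \<mu>: prob_space ?\<mu> by (rule prob_space_discrete_design)
  interpret \<nu>: prob_space ?\<nu> by (rule prob_space_discrete_design)
  interpret pair_prob_space ?\<mu> ?\<nu> ..
  have F: "integrable ?\<mu> f" and G: "integrable ?\<nu> g"
    using assms by (auto intro: integrable_discrete_design)
  have int: "integrable (?\<mu> \<Otimes>\<^sub>M ?\<nu>) (\<lambda>x. f (fst x) * g (snd x))"
    by (rule Fubini_integrable) (use F G in \<open>auto simp: abs_mult\<close>)
  have "(\<integral>x. f (fst x) * g (snd x) \<partial>(?\<mu> \<Otimes>\<^sub>M ?\<nu>)) = (\<integral>x. (\<integral>y. f x * g y \<partial>?\<nu>) \<partial>?\<mu>)"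
    using integral_fst'[OF int] by simp
  then show ?thesis by simp
qed

lemma is_design_product:
  assumes "pmf_of_list_wf (zip pts ws)" "pmf_of_list_wf (zip pts' ws')"
    and "set pts \<subseteq> {0..pi}" "set pts' \<subseteq> {- pi<..pi}"
  shows "is_design (discrete_design pts ws \<Otimes>\<^sub>M discrete_design pts' ws')"
proof -
  let ?\<mu> = "discrete_design pts ws" and ?\<nu> = "discrete_design pts' ws'"
  interpret \<mu>: prob_space ?\<mu> by (rule prob_space_discrete_design)
  interpret \<nu>: prob_space ?\<nu> by (rule prob_space_discrete_design)
  interpret pair_prob_space ?\<mu> ?\<nu> ..
  have "sets (?\<mu> \<Otimes>\<^sub>M ?\<nu>) = sets (borel \<Otimes>\<^sub>M borel :: (real \<times> real) measure)"
    by (intro sets_pair_measure_cong sets_discrete_design)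
  then have "sets (?\<mu> \<Otimes>\<^sub>M ?\<nu>) = sets (borel :: (real \<times> real) measure)"
    by (simp only: borel_prod)
  moreover have "emeasure (?\<mu> \<Otimes>\<^sub>M ?\<nu>) design_region = 1"
    unfolding design_region_def
    using assms by (subst \<nu>.emeasure_pair_measure_Times) (auto simp: emeasure_discrete_design_eq_1 sets_discrete_design)
  ultimately show ?thesis
    unfolding is_design_def using prob_space_axioms by simp
qed

lemma measurable_polar_part [measurable]: "polar_part n m \<in> borel_measurable borel"
  unfolding polar_part_def by (intro borel_measurable_continuous_onI continuous_intros)

lemma measurable_azimuthal_part [measurable]: "azimuthal_part m \<in> borel_measurable borel"
  unfolding azimuthal_part_def
  by (cases m "0 :: int" rule: linorder_cases)
    (auto intro!: borel_measurable_continuous_onI continuous_intros)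

lemma measurable_sph_harm [measurable]:
  "(\<lambda>x. sph_harm n m (fst x) (snd x)) \<in> borel_measurable (borel :: (real \<times> real) measure)"
  unfolding sph_harm_factor
  by (intro borel_measurable_times measurable_compose[OF _ measurable_polar_part]
      measurable_compose[OF _ measurable_azimuthal_part])
    (intro borel_measurable_continuous_onI continuous_intros)+

section \<open>Indexing of the harmonics and selection of degrees\<close>

lemma set_sh_index: "set (sh_index d) = (SIGMA n:{..d}. {- int n..int n})"
  by (auto simp: sh_index_def less_Suc_eq_le simp del: upt_Suc)

lemma nat_two_mult_int_Suc: "nat (2 * int n + 1) = Suc (2 * n)"
  by simp

lemma length_sh_index: "length (sh_index d) = (d + 1)\<^sup>2"
proof -
  have "length (sh_index d) = (\<Sum>n<Suc d. 2 * n + 1)"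
    unfolding sh_index_def length_concat map_map comp_def
    by (simp add: interv_sum_list_conv_sum_set_nat atLeast0LessThan nat_two_mult_int_Suc del: upt_Suc)
  also have "\<dots> = (d + 1)\<^sup>2"
    by (induction d) (simp_all add: power2_eq_square)
  finally show ?thesis .
qed

lemma distinct_sh_index: "distinct (sh_index d)"
proof (rule card_distinct)
  have "card (set (sh_index d)) = (\<Sum>n\<le>d. 2 * n + 1)"
    unfolding set_sh_index by (subst card_SigmaI) (auto simp: nat_two_mult_int_Suc)
  also have "\<dots> = (d + 1)\<^sup>2"
    by (induction d) (simp_all add: power2_eq_square)
  finally show "card (set (sh_index d)) = length (sh_index d)" by (simp add: length_sh_index)
qed

text \<open>Turns sums over vector positions into sums over whole degree blocks, the shape in which
  the addition theorem applies.\<close>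

lemma sum_sel_positions:
  "(\<Sum>j\<in>set (sel_positions d ns). g (sh_index d ! j))
     = (\<Sum>n\<in>{..d} \<inter> ns. \<Sum>m\<in>{- int n..int n}. g (n, m))"
proof -
  have "bij_betw ((!) (sh_index d)) (set (sel_positions d ns)) {u \<in> set (sh_index d). fst u \<in> ns}"
  proof -
    have "inj_on ((!) (sh_index d)) (set (sel_positions d ns))"
      using distinct_sh_index[of d] length_sh_index[of d]
      by (auto simp: sel_positions_def inj_on_def nth_eq_iff_index_eq)
    moreover have "(!) (sh_index d) ` set (sel_positions d ns) = {u \<in> set (sh_index d). fst u \<in> ns}"
      using length_sh_index[of d] by (force simp: sel_positions_def in_set_conv_nth)
    ultimately show ?thesis by (simp add: bij_betw_def)
  qed
  then have "(\<Sum>j\<in>set (sel_positions d ns). g (sh_index d ! j)) = (\<Sum>u\<in>{u \<in> set (sh_index d). fst u \<in> ns}. g u)"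
    by (rule sum.reindex_bij_betw)
  also have "{u \<in> set (sh_index d). fst u \<in> ns} = (SIGMA n:{..d} \<inter> ns. {- int n..int n})"
    by (auto simp: set_sh_index)
  finally show ?thesis by (simp add: sum.Sigma case_prod_unfold)
qed

lemma distinct_sel_positions: "distinct (sel_positions d ns)"
  and sel_positions_less: "j \<in> set (sel_positions d ns) \<Longrightarrow> j < (d + 1)\<^sup>2"
  by (auto simp: sel_positions_def)

lemma length_sel_positions: "length (sel_positions d ns) = (\<Sum>n\<in>{..d} \<inter> ns. 2 * n + 1)"
proof -
  have "length (sel_positions d ns) = (\<Sum>j\<in>set (sel_positions d ns). 1)"
    by (simp add: distinct_card distinct_sel_positions)
  also have "\<dots> = (\<Sum>n\<in>{..d} \<inter> ns. 2 * n + 1)"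
    using sum_sel_positions[of "\<lambda>_. 1 :: nat" d ns] by (simp add: nat_two_mult_int_Suc)
  finally show ?thesis .
qed

text \<open>Selecting all degrees makes the full trace an instance of the block sums.\<close>

lemma sel_positions_UNIV: "sel_positions d UNIV = [0..<(d + 1)\<^sup>2]"
  by (simp add: sel_positions_def)

abbreviation sph_basis :: "nat \<Rightarrow> nat \<Rightarrow> real \<times> real \<Rightarrow> real" where
  "sph_basis d j x \<equiv> case_prod sph_harm (sh_index d ! j) (fst x) (snd x)"

lemma regvec_nth:
  assumes "j < (d + 1)\<^sup>2"
  shows "regvec d x ! j = sph_basis d j x"
  using assms by (simp add: regvec_def length_sh_index case_prod_unfold)

lemma sh_index_nth_bound:
  assumes "j < (d + 1)\<^sup>2" "sh_index d ! j = (n, m)"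
  shows "n \<le> d" "\<bar>m\<bar> \<le> int n"
proof -
  have "(n, m) \<in> set (sh_index d)" using assms by (metis length_sh_index nth_mem)
  then show "n \<le> d" "\<bar>m\<bar> \<le> int n" by (auto simp: set_sh_index)
qed

lemma measurable_sph_basis [measurable]:
  "sph_basis d j \<in> borel_measurable (borel :: (real \<times> real) measure)"
  by (cases "sh_index d ! j") (simp add: measurable_sph_harm)

lemma abs_sph_basis_le:
  assumes "j < (d + 1)\<^sup>2"
  shows "\<bar>sph_basis d j x\<bar> \<le> sqrt (2 * real d + 1)"
proof -
  obtain n m where nm: "sh_index d ! j = (n, m)" by (cases "sh_index d ! j")
  have "(sph_harm n m (fst x) (snd x))\<^sup>2 \<le> 2 * real n + 1"
    by (rule sph_harm_sq_le) (use sh_index_nth_bound[OF assms nm] in simp)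
  also have "\<dots> \<le> 2 * real d + 1" using sh_index_nth_bound[OF assms nm] by simp
  finally show ?thesis unfolding nm by (simp add: real_le_rsqrt)
qed

lemma integrable_sph_basis_mult:
  assumes \<xi>: "is_design \<xi>" and "i < (d + 1)\<^sup>2" "j < (d + 1)\<^sup>2"
  shows "integrable \<xi> (\<lambda>x. sph_basis d i x * sph_basis d j x)"
proof -
  interpret prob_space \<xi> using \<xi> by (simp add: is_design_def)
  have [measurable_cong]: "sets \<xi> = sets borel" using \<xi> by (simp add: is_design_def)
  show ?thesis
  proof (rule integrable_const_bound[where B = "sqrt (2 * real d + 1) * sqrt (2 * real d + 1)"])
    show "AE x in \<xi>. norm (sph_basis d i x * sph_basis d j x) \<le> sqrt (2 * real d + 1) * sqrt (2 * real d + 1)"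
      unfolding real_norm_def abs_mult by (intro AE_I2 mult_mono abs_sph_basis_le assms) simp_all
    show "(\<lambda>x. sph_basis d i x * sph_basis d j x) \<in> borel_measurable \<xi>"
      by measurable
  qed
qed

section \<open>Information matrices and selection matrices\<close>

lemma info_mat_carrier: "info_mat d \<xi> \<in> carrier_mat ((d + 1)\<^sup>2) ((d + 1)\<^sup>2)"
  by (simp add: info_mat_def)

lemma info_mat_index:
  assumes "i < (d + 1)\<^sup>2" "j < (d + 1)\<^sup>2"
  shows "info_mat d \<xi> $$ (i, j) = (\<integral>x. sph_basis d i x * sph_basis d j x \<partial>\<xi>)"
  using assms by (simp add: info_mat_def regvec_nth)

text \<open>The quadratic form at v is the integral of the square of v^T f_d.\<close>

lemma psd_info_mat:
  assumes \<xi>: "is_design \<xi>"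
  shows "psd_mat ((d + 1)\<^sup>2) (info_mat d \<xi>)"
proof -
  let ?N = "(d + 1)\<^sup>2" and ?M = "info_mat d \<xi>"
  have "?M\<^sup>T = ?M"
    by (rule eq_matI) (auto simp: info_mat_def mult.commute)
  moreover have "0 \<le> v \<bullet> (?M *\<^sub>v v)" if v: "v \<in> carrier_vec ?N" for v
  proof -
    have int: "integrable \<xi> (\<lambda>x. v $ i * (v $ j * (sph_basis d i x * sph_basis d j x)))"
      if "i < ?N" "j < ?N" for i j
      using integrable_sph_basis_mult[OF \<xi> that] by auto
    have "v \<bullet> (?M *\<^sub>v v) = (\<Sum>i<?N. \<Sum>j<?N. v $ i * (v $ j * ?M $$ (i, j)))"
      using v info_mat_carrier[of d \<xi>]
      by (auto simp: scalar_prod_def atLeast0LessThan sum_distrib_left mult_ac intro!: sum.cong)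
    also have "\<dots> = (\<Sum>i<?N. \<Sum>j<?N. \<integral>x. v $ i * (v $ j * (sph_basis d i x * sph_basis d j x)) \<partial>\<xi>)"
      by (intro sum.cong refl) (simp add: info_mat_index)
    also have "\<dots> = (\<integral>x. (\<Sum>i<?N. \<Sum>j<?N. v $ i * (v $ j * (sph_basis d i x * sph_basis d j x))) \<partial>\<xi>)"
    proof -
      let ?h = "\<lambda>i j x. v $ i * (v $ j * (sph_basis d i x * sph_basis d j x))"
      have "(\<integral>x. (\<Sum>i<?N. \<Sum>j<?N. ?h i j x) \<partial>\<xi>) = (\<Sum>i<?N. \<integral>x. (\<Sum>j<?N. ?h i j x) \<partial>\<xi>)"
        by (intro Bochner_Integration.integral_sum Bochner_Integration.integrable_sum int) auto
      also have "\<dots> = (\<Sum>i<?N. \<Sum>j<?N. \<integral>x. ?h i j x \<partial>\<xi>)"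
        by (intro sum.cong refl Bochner_Integration.integral_sum int) auto
      finally show ?thesis by (rule sym)
    qed
    also have "\<dots> = (\<integral>x. (\<Sum>i<?N. v $ i * sph_basis d i x)\<^sup>2 \<partial>\<xi>)"
    proof -
      have "(\<Sum>i<k. \<Sum>j<k. v $ i * (v $ j * (sph_basis d i x * sph_basis d j x)))
          = (\<Sum>i<k. v $ i * sph_basis d i x)\<^sup>2" for k x
        by (simp add: power2_eq_square sum_product mult_ac)
      then show ?thesis by presburger
    qed
    also have "\<dots> \<ge> 0" by simp
    finally show ?thesis .
  qed
  ultimately show ?thesis unfolding psd_mat_def using info_mat_carrier by blast
qed

text \<open>By the addition theorem the integrand is constant in x, so the design does not influence
  its integral.\<close>

lemma sum_info_mat_diagonal:
  assumes \<xi>: "is_design \<xi>"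
  shows "(\<Sum>j\<in>set (sel_positions d ns). info_mat d \<xi> $$ (j, j)) = real (length (sel_positions d ns))"
proof -
  interpret prob_space \<xi> using \<xi> by (simp add: is_design_def)
  have "(\<Sum>j\<in>set (sel_positions d ns). info_mat d \<xi> $$ (j, j))
      = (\<Sum>j\<in>set (sel_positions d ns). \<integral>x. sph_basis d j x * sph_basis d j x \<partial>\<xi>)"
    by (intro sum.cong refl info_mat_index sel_positions_less)
  also have "\<dots> = (\<integral>x. (\<Sum>j\<in>set (sel_positions d ns). sph_basis d j x * sph_basis d j x) \<partial>\<xi>)"
    by (intro Bochner_Integration.integral_sum[symmetric] integrable_sph_basis_mult[OF \<xi>] sel_positions_less)
  also have "\<dots> = (\<integral>x. real (length (sel_positions d ns)) \<partial>\<xi>)"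
  proof (rule Bochner_Integration.integral_cong[OF refl])
    fix x :: "real \<times> real"
    show "(\<Sum>j\<in>set (sel_positions d ns). sph_basis d j x * sph_basis d j x) = real (length (sel_positions d ns))"
      unfolding sum_sel_positions[of "\<lambda>u. case_prod sph_harm u (fst x) (snd x) * case_prod sph_harm u (fst x) (snd x)"]
        length_sel_positions
      by (simp add: power2_eq_square[symmetric] sph_harm_addition)
  qed
  finally show ?thesis by (simp add: prob_space)
qed

lemma selection_mat_carrier:
  "selection_mat d ns \<in> carrier_mat ((d + 1)\<^sup>2) (length (sel_positions d ns))"
  by (simp add: selection_mat_def)

lemma selection_mat_congruence_index:
  assumes M: "M \<in> carrier_mat ((d + 1)\<^sup>2) ((d + 1)\<^sup>2)"
    and a: "a < length (sel_positions d ns)" and b: "b < length (sel_positions d ns)"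
  shows "((selection_mat d ns)\<^sup>T * M * selection_mat d ns) $$ (a, b)
       = M $$ (sel_positions d ns ! a, sel_positions d ns ! b)"
proof -
  let ?N = "(d + 1)\<^sup>2" and ?p = "sel_positions d ns" and ?K = "selection_mat d ns"
  have less: "?p ! a < ?N" "?p ! b < ?N"
    by (rule sel_positions_less[OF nth_mem[OF a]], rule sel_positions_less[OF nth_mem[OF b]])
  have KM: "(?K\<^sup>T * M) $$ (a, j) = M $$ (?p ! a, j)" if "j < ?N" for j
  proof -
    have "(?K\<^sup>T * M) $$ (a, j) = (\<Sum>i<?N. ?K $$ (i, a) * M $$ (i, j))"
      using M a that selection_mat_carrier[of d ns] by (simp add: scalar_prod_def atLeast0LessThan)
    also have "\<dots> = (\<Sum>i<?N. (if i = ?p ! a then M $$ (i, j) else 0))"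
      by (intro sum.cong refl) (use a in \<open>auto simp: selection_mat_def\<close>)
    finally show ?thesis using less by simp
  qed
  have "(?K\<^sup>T * M * ?K) $$ (a, b) = (\<Sum>j<?N. (?K\<^sup>T * M) $$ (a, j) * ?K $$ (j, b))"
  proof -
    have "(X * ?K) $$ (a, b) = (\<Sum>j<?N. X $$ (a, j) * ?K $$ (j, b))"
      if "X \<in> carrier_mat (length ?p) ?N" for X
      using that a b selection_mat_carrier[of d ns] by (simp add: scalar_prod_def atLeast0LessThan)
    moreover have "?K\<^sup>T * M \<in> carrier_mat (length ?p) ?N"
      using M selection_mat_carrier[of d ns] by auto
    ultimately show ?thesis by blast
  qed
  also have "\<dots> = (\<Sum>j<?N. (if j = ?p ! b then M $$ (?p ! a, j) else 0))"
    by (intro sum.cong refl) (use b KM in \<open>auto simp: selection_mat_def\<close>)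
  also have "\<dots> = M $$ (?p ! a, ?p ! b)" using less by simp
  finally show ?thesis .
qed

lemma selection_mat_orthonormal:
  "(selection_mat d ns)\<^sup>T * selection_mat d ns = 1\<^sub>m (length (sel_positions d ns))"
proof -
  let ?N = "(d + 1)\<^sup>2" and ?p = "sel_positions d ns" and ?K = "selection_mat d ns"
  have K: "?K \<in> carrier_mat ?N (length ?p)" by (rule selection_mat_carrier)
  \<comment> \<open>Inserting the identity makes this the case M = 1 of
    \<open>selection_mat_congruence_index\<close>.\<close>
  have "?K\<^sup>T * 1\<^sub>m ?N * ?K = 1\<^sub>m (length ?p)"
  proof (rule eq_matI)
    fix a b assume "a < dim_row (1\<^sub>m (length ?p) :: real mat)" "b < dim_col (1\<^sub>m (length ?p) :: real mat)"
    then have ab: "a < length ?p" "b < length ?p" by simp_all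
    have less: "?p ! a < ?N" "?p ! b < ?N"
      by (rule sel_positions_less[OF nth_mem[OF ab(1)]], rule sel_positions_less[OF nth_mem[OF ab(2)]])
    show "(?K\<^sup>T * 1\<^sub>m ?N * ?K) $$ (a, b) = 1\<^sub>m (length ?p) $$ (a, b)"
      using ab less distinct_sel_positions[of d ns]
      by (simp add: selection_mat_congruence_index nth_eq_iff_index_eq del: index_mult_mat(1))
  qed (use K in auto)
  then show ?thesis using K by simp
qed

section \<open>Upper bounds for the criteria\<close>

lemma Psi_crit_eq: "Psi_crit p r M = mean_crit p (take r (sorted_eigs M))"
  by (simp add: Psi_crit_def mean_crit_def Let_def)

text \<open>The trace is (d + 1)^2, so all eigenvalues have mean 1 and the r smallest have mean at
  most 1.\<close>

lemma Psi_crit_le: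
  assumes \<xi>: "is_design \<xi>" and "p < 1" "1 \<le> r" "r \<le> (d + 1)\<^sup>2"
  shows "Psi_crit p r (info_mat d \<xi>) \<le> Psi_crit p r (1\<^sub>m ((d + 1)\<^sup>2))"
proof -
  let ?N = "(d + 1)\<^sup>2" and ?M = "info_mat d \<xi>"
  let ?es = "sorted_eigs ?M"
  have psd: "psd_mat ?N ?M" by (rule psd_info_mat[OF \<xi>])
  then have "?M \<in> carrier_mat ?N ?N" "?M\<^sup>T = ?M" by (auto simp: psd_mat_def)
  note eigs = symmetric_sorted_eigs[OF this]
  have "sum_list ?es = real (length (sel_positions d UNIV))"
    unfolding eigs(4) sum_info_mat_diagonal[OF \<xi>, symmetric]
    by (simp add: sel_positions_UNIV atLeast0LessThan)
  then have "sum_list (take r ?es) \<le> real r"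
    using eigs assms(4) by (intro sum_list_take_sorted_le) (auto simp: sel_positions_UNIV)
  moreover have len: "length (take r ?es) = r" using eigs(3) assms(4) by simp
  moreover have "take r ?es \<noteq> []" using len assms(3) by auto
  moreover have "0 \<le> e" if "e \<in> set (take r ?es)" for e
    using that eigs(6) psd_mat_eigenvalue[OF psd] by (meson in_set_takeD)
  ultimately have "mean_crit p (take r ?es) \<le> mean_crit p (replicate (length (take r ?es)) 1)"
    using assms(2) eigs(1) by (intro mean_crit_le_ones) auto
  then show ?thesis
    unfolding Psi_crit_eq sorted_eigs_one len using assms(4) by (simp add: min_def)
qed

text \<open>Positivity of the smallest eigenvalue keeps \<open>mean_crit\<close> out of its zero
  branch, and the determinant is the product of the spectrum.\<close>

lemma Phi_crit_eq:
  assumes "C \<in> carrier_mat s s" "C\<^sup>T = C" "s > 0" "\<And>e. eigenvalue C e \<Longrightarrow> 0 < e"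
  shows "Phi_crit p C = mean_crit p (sorted_eigs C)"
proof -
  note eigs = symmetric_sorted_eigs[OF assms(1,2)]
  have "sorted_eigs C \<noteq> []" using eigs(3) assms(3) by auto
  then have "0 < hd (sorted_eigs C)" using eigs(6) assms(4) by simp
  then show ?thesis by (simp add: Phi_crit_def mean_crit_def eigs(5))
qed

text \<open>At the identity both choices are forced: 1 G 1 = 1 and 1 B = 1 leave only the
  identity.\<close>

lemma C_K_one:
  assumes K: "K \<in> carrier_mat n s" "K\<^sup>T * K = 1\<^sub>m s"
  shows "C_K K (1\<^sub>m n) = 1\<^sub>m s"
proof -
  have "ginv (1\<^sub>m n) = 1\<^sub>m n"
    using ginv_property[of "1\<^sub>m n" n n] by simp
  moreover have "minv (1\<^sub>m s) = 1\<^sub>m s"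
    using minv_right_inverse[of "1\<^sub>m s" s] by simp
  ultimately show ?thesis unfolding C_K_def using K by simp
qed

text \<open>The trace of \<open>C_K\<close> is at most that of K^T M K, which is the selected part
  of the diagonal of M and sums to the number of selected coefficients.\<close>

lemma Phi_crit_le:
  assumes \<xi>: "is_design \<xi>" and p: "p < 1" and ne: "sel_positions d ns \<noteq> []"
    and est: "estimable (selection_mat d ns) (info_mat d \<xi>)"
  shows "Phi_crit p (C_K (selection_mat d ns) (info_mat d \<xi>))
       \<le> Phi_crit p (C_K (selection_mat d ns) (1\<^sub>m ((d + 1)\<^sup>2)))"
proof -
  let ?s = "length (sel_positions d ns)" and ?p = "sel_positions d ns"
  let ?K = "selection_mat d ns" and ?M = "info_mat d \<xi>"
  let ?C = "C_K ?K ?M"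
  have psdM: "psd_mat ((d + 1)\<^sup>2) ?M" by (rule psd_info_mat[OF \<xi>])
  note C = C_K_psd_bounds[OF psdM selection_mat_carrier selection_mat_orthonormal est]
  have cC: "?C \<in> carrier_mat ?s ?s" and sC: "?C\<^sup>T = ?C" using C(1) by (auto simp: psd_mat_def)
  note eigs = symmetric_sorted_eigs[OF cC sC]
  have s: "?s > 0" using ne by simp
  have "sum_list (sorted_eigs ?C) \<le> (\<Sum>a<?s. (?K\<^sup>T * ?M * ?K) $$ (a, a))"
    unfolding eigs(4) by (intro sum_mono C(3)) simp
  also have "\<dots> = (\<Sum>a<?s. ?M $$ (?p ! a, ?p ! a))"
    by (intro sum.cong refl selection_mat_congruence_index info_mat_carrier) simp_all
  also have "\<dots> = (\<Sum>j\<in>set ?p. ?M $$ (j, j))"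
    by (intro sum.reindex_bij_betw bij_betw_nth distinct_sel_positions) auto
  also have "\<dots> = real ?s" by (rule sum_info_mat_diagonal[OF \<xi>])
  finally have "sum_list (sorted_eigs ?C) \<le> real (length (sorted_eigs ?C))"
    unfolding eigs(3) .
  then have "mean_crit p (sorted_eigs ?C) \<le> mean_crit p (replicate (length (sorted_eigs ?C)) 1)"
    using eigs(1,3) s C(2) eigs(6) by (intro mean_crit_le_ones p) (auto intro: less_imp_le)
  moreover have "Phi_crit p (1\<^sub>m ?s) = mean_crit p (replicate ?s 1)"
    using s by (simp add: Phi_crit_def mean_crit_def sorted_eigs_one)
  ultimately show ?thesis
    unfolding C_K_one[OF selection_mat_carrier selection_mat_orthonormal]
    using Phi_crit_eq[OF cC sC s C(2)] eigs(3) by simp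
qed

lemma optimal_of_info_mat_one:
  assumes \<xi>: "is_design \<xi>" and one: "info_mat d \<xi> = 1\<^sub>m ((d + 1)\<^sup>2)" and p: "p < 1"
  shows "sel_positions d ns \<noteq> [] \<Longrightarrow> Phi_optimal d p (selection_mat d ns) \<xi>"
    and "1 \<le> r \<Longrightarrow> r \<le> (d + 1)\<^sup>2 \<Longrightarrow> Psi_optimal d p r \<xi>"
proof -
  show "Psi_optimal d p r \<xi>" if "1 \<le> r" "r \<le> (d + 1)\<^sup>2"
    unfolding Psi_optimal_def one using \<xi> Psi_crit_le[OF _ p that] by blast
  have "estimable (selection_mat d ns) (1\<^sub>m ((d + 1)\<^sup>2))"
    unfolding estimable_def using selection_mat_carrier[of d ns]
    by (auto intro!: bexI[of _ "selection_mat d ns *\<^sub>v _"])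
  then show "Phi_optimal d p (selection_mat d ns) \<xi>" if "sel_positions d ns \<noteq> []"
    unfolding Phi_optimal_def one using \<xi> Phi_crit_le[OF _ p that] by blast
qed

section \<open>The product design\<close>

lemma sum_list_zip_map_interval:
  fixes g :: "'a \<Rightarrow> real"
  shows "(\<Sum>(x, w)\<leftarrow>zip (map f [1..<n + 1]) (map c [1..<n + 1]). w * g x) = (\<Sum>i=1..n. c i * g (f i))"
proof -
  have "zip (map f [1..<n + 1]) (map c [1..<n + 1]) = map (\<lambda>i. (f i, c i)) [1..<n + 1]"
    by (simp add: zip_map_map zip_same_conv_map del: upt_Suc)
  then have "(\<Sum>(x, w)\<leftarrow>zip (map f [1..<n + 1]) (map c [1..<n + 1]). w * g x)
      = sum (\<lambda>i. c i * g (f i)) (set [1..<n + 1])"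
    by (simp add: comp_def sum_list_distinct_conv_sum_set del: upt_Suc set_upt)
  also have "set [1..<n + 1] = {1..n}" by auto
  finally show ?thesis .
qed

lemma pmf_of_list_wf_zip_map:
  fixes c :: "nat \<Rightarrow> real"
  assumes "\<And>i. i \<in> {1..n} \<Longrightarrow> 0 \<le> c i" "(\<Sum>i=1..n. c i) = 1"
  shows "pmf_of_list_wf (zip (map f [1..<n + 1]) (map c [1..<n + 1]))"
proof (rule pmf_of_list_wfI)
  show "0 \<le> u" if "u \<in> set (map snd (zip (map f [1..<n + 1]) (map c [1..<n + 1])))" for u
    using that assms(1) by (auto simp del: upt_Suc)
  have "sum_list (map snd (zip (map f [1..<n + 1]) (map c [1..<n + 1])))
      = (\<Sum>(x, w)\<leftarrow>zip (map f [1..<n + 1]) (map c [1..<n + 1]). w * 1)"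
    by (simp add: case_prod_unfold del: upt_Suc)
  then show "sum_list (map snd (zip (map f [1..<n + 1]) (map c [1..<n + 1]))) = 1"
    unfolding sum_list_zip_map_interval using assms(2) by simp
qed

lemma discrete_design_interval:
  fixes c :: "nat \<Rightarrow> real" and g :: "real \<Rightarrow> real"
  assumes "\<And>i. i \<in> {1..n} \<Longrightarrow> 0 \<le> c i" "(\<Sum>i=1..n. c i) = 1" "g \<in> borel_measurable borel"
  shows "(\<integral>x. g x \<partial>discrete_design (map f [1..<n + 1]) (map c [1..<n + 1])) = (\<Sum>i=1..n. c i * g (f i))"
  using integral_discrete_design[OF pmf_of_list_wf_zip_map[OF assms(1,2)] assms(3), of f]
  by (simp only: sum_list_zip_map_interval)

lemma info_mat_product_design:
  fixes x w :: "nat \<Rightarrow> real"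
  assumes x: "\<And>i. i \<in> {1..r} \<Longrightarrow> - 1 \<le> x i \<and> x i \<le> 1"
    and w: "\<And>i. i \<in> {1..r} \<Longrightarrow> 0 \<le> w i" "(\<Sum>i=1..r. w i) = 1"
    and quad: "\<And>l. l \<le> 2 * d \<Longrightarrow> (\<Sum>i=1..r. w i * x i ^ l) = integral {-1..1} (\<lambda>y. y ^ l) / 2"
    and t: "2 * d + 1 \<le> t"
  shows "info_mat d (discrete_design (map (\<lambda>i. arccos (x i)) [1..<r + 1]) (map w [1..<r + 1])
      \<Otimes>\<^sub>M discrete_design (map (\<lambda>j. \<alpha> + 2 * pi * real j / real t) [1..<t + 1])
           (map (\<lambda>_. 1 / real t) [1..<t + 1])) = 1\<^sub>m ((d + 1)\<^sup>2)"
    (is "info_mat d (?\<mu> \<Otimes>\<^sub>M ?\<nu>) = _")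
proof (rule eq_matI)
  let ?N = "(d + 1)\<^sup>2"
  have u: "0 \<le> 1 / real t" "(\<Sum>j=1..t. 1 / real t) = 1" using t by auto
  fix i j assume "i < dim_row (1\<^sub>m ?N :: real mat)" "j < dim_col (1\<^sub>m ?N :: real mat)"
  then have ij: "i < ?N" "j < ?N" by simp_all
  obtain n m where i: "sh_index d ! i = (n, m)" by (cases "sh_index d ! i")
  obtain l m' where j: "sh_index d ! j = (l, m')" by (cases "sh_index d ! j")
  note nm = sh_index_nth_bound[OF ij(1) i] and lm = sh_index_nth_bound[OF ij(2) j]
  define P where "P \<theta> = polar_part n (nat \<bar>m\<bar>) \<theta> * polar_part l (nat \<bar>m'\<bar>) \<theta>" for \<theta>
  define Z where "Z \<phi> = azimuthal_part m \<phi> * azimuthal_part m' \<phi>" for \<phi>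
  have P: "P \<in> borel_measurable borel" and Z: "Z \<in> borel_measurable borel"
    unfolding P_def Z_def by measurable
  have "info_mat d (?\<mu> \<Otimes>\<^sub>M ?\<nu>) $$ (i, j) = (\<integral>x. P (fst x) * Z (snd x) \<partial>(?\<mu> \<Otimes>\<^sub>M ?\<nu>))"
    unfolding info_mat_index[OF ij] i j
    by (simp add: sph_harm_factor P_def Z_def mult_ac)
  also have "\<dots> = (\<integral>\<theta>. P \<theta> \<partial>?\<mu>) * (\<integral>\<phi>. Z \<phi> \<partial>?\<nu>)"
    by (intro integral_product_design pmf_of_list_wf_zip_map P Z w u)
  also have "(\<integral>\<phi>. Z \<phi> \<partial>?\<nu>) = (if m = m' then 1 else 0)"
  proof -
    have "(\<integral>\<phi>. Z \<phi> \<partial>?\<nu>) = (\<Sum>j=1..t. 1 / real t * Z (\<alpha> + 2 * pi * real j / real t))"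
      by (rule discrete_design_interval[OF u Z])
    also have "\<dots> = (if m = m' then 1 else 0)"
      unfolding Z_def by (rule azimuthal_orthonormal[OF _ _ t]) (use nm lm in auto)
    finally show ?thesis .
  qed
  \<comment> \<open>Only for equal orders is \<open>P\<close> a polynomial in cos theta covered by
    \<open>polar_part_mult\<close>; for other pairs the azimuthal factor is already 0.\<close>
  also have "(\<integral>\<theta>. P \<theta> \<partial>?\<mu>) = (if n = l then 1 else 0)" if m: "m = m'"
  proof -
    define k where "k = nat \<bar>m\<bar>"
    have k: "k \<le> n" "k \<le> l" using nm lm m by (auto simp: k_def)
    have "(\<integral>\<theta>. P \<theta> \<partial>?\<mu>) = (\<Sum>i=1..r. w i * P (arccos (x i)))"
      by (rule discrete_design_interval[OF w P])
    also have "\<dots> = sqrt (legendre_norm n k) * sqrt (legendre_norm l k)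
        * (\<Sum>i=1..r. w i * poly (legendre_prod n l k) (x i))"
      unfolding sum_distrib_left P_def m[symmetric] k_def[symmetric] polar_part_mult
      by (intro sum.cong refl) (use x in \<open>auto simp: mult_ac\<close>)
    also have "(\<Sum>i=1..r. w i * poly (legendre_prod n l k) (x i)) = poly_mean (legendre_prod n l k)"
      using degree_legendre_prod[OF k] nm lm by (intro quadrature_poly_mean[OF quad]) auto
    also have "sqrt (legendre_norm n k) * sqrt (legendre_norm l k) * poly_mean (legendre_prod n l k)
        = (if n = l then 1 else 0)"
    proof (cases "n = l")
      case True
      then show ?thesis
        using legendre_norm_nonneg[of n k]
        by (simp add: poly_mean_legendre_prod_norm[OF k(2)] legendre_norm_def)
    qed (simp add: poly_mean_legendre_prod_orthogonal[OF k(1)])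
    finally show ?thesis .
  qed
  then have "(\<integral>\<theta>. P \<theta> \<partial>?\<mu>) * (if m = m' then 1 else 0) = (if (n, m) = (l, m') then 1 else 0)"
    by simp
  also have "\<dots> = (if i = j then 1 else 0)"
    using nth_eq_iff_index_eq[OF distinct_sh_index, of i d j] ij i j by (simp add: length_sh_index)
  finally show "info_mat d (?\<mu> \<Otimes>\<^sub>M ?\<nu>) $$ (i, j) = 1\<^sub>m ?N $$ (i, j)"
    using ij by simp
qed (simp_all add: info_mat_def)

theorem theorem3p2:
  fixes d q r t :: nat and p :: ereal and k :: "nat \<Rightarrow> nat"
    and x w :: "nat \<Rightarrow> real" and \<alpha> :: real
  assumes "d \<ge> 1"
    and "p < 1"
    and "strict_mono_on {0..q} k" and "k q \<le> d"
    and "d + 1 \<le> r" and "r \<le> 2 * d"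
    and "strict_mono_on {1..r} x" and "\<forall>i\<in>{1..r}. -1 \<le> x i \<and> x i \<le> 1"
    and "\<forall>i\<in>{1..r}. w i > 0" and "(\<Sum>i=1..r. w i) = 1"
    and "\<forall>l\<le>2*d. (\<Sum>i=1..r. w i * x i ^ l) = integral {-1..1} (\<lambda>y. y ^ l) / 2"
    and "t \<ge> 2 * d + 1"
    and "- (real t + 1) / real t * pi < \<alpha>" and "\<alpha> \<le> - pi"
  shows "let \<mu> = discrete_design (map (\<lambda>i. arccos (x i)) [1..<r+1]) (map w [1..<r+1]);
             \<nu> = discrete_design (map (\<lambda>j. \<alpha> + 2 * pi * real j / real t) [1..<t+1])
                                 (replicate t (1 / real t));
             K = selection_mat d (k ` {0..q})
         in Phi_optimal d p K (\<mu> \<Otimes>\<^sub>M \<nu>) \<and>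
            (\<forall>r'. 1 \<le> r' \<and> r' \<le> (d+1)\<^sup>2 \<longrightarrow> Psi_optimal d p r' (\<mu> \<Otimes>\<^sub>M \<nu>))"
proof -
  let ?\<theta> = "map (\<lambda>i. arccos (x i)) [1..<r + 1]" and ?w = "map w [1..<r + 1]"
  let ?\<phi> = "map (\<lambda>j. \<alpha> + 2 * pi * real j / real t) [1..<t + 1]"
    and ?u = "map (\<lambda>_. 1 / real t) [1..<t + 1]"
  let ?\<xi> = "discrete_design ?\<theta> ?w \<Otimes>\<^sub>M discrete_design ?\<phi> ?u"
  have u: "replicate t (1 / real t) = ?u"
    by (simp add: map_replicate_const del: upt_Suc)
  have t: "real t > 0" using assms(12) by simp
  have "set ?\<theta> \<subseteq> {0..pi}"
    using assms(8) by (auto intro!: arccos_lbound arccos_ubound simp del: upt_Suc)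
  moreover have "set ?\<phi> \<subseteq> {- pi<..pi}"
  proof -
    have "- pi < \<alpha> + 2 * pi * real j / real t \<and> \<alpha> + 2 * pi * real j / real t \<le> pi"
      if "1 \<le> j" "j \<le> t" for j
    proof
      \<comment> \<open>The leftmost point has j = 1. The strict lower bound on \<alpha> puts it to
        the right of -pi + pi / t.\<close>
      have "- pi < - pi + pi / real t" using t by simp
      also have "\<dots> = - (real t + 1) / real t * pi + 2 * pi / real t"
        using t by (simp add: field_simps)
      also have "\<dots> < \<alpha> + 2 * pi / real t" using assms(13) by simp
      also have "\<dots> \<le> \<alpha> + 2 * pi * real j / real t"
        using that t by (simp add: divide_right_mono)
      finally show "- pi < \<alpha> + 2 * pi * real j / real t" .
      \<comment> \<open>The rightmost point has j = t and equals \<alpha> + 2 pi, which may reach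
        the included end pi.\<close>
      have "2 * pi * real j / real t \<le> 2 * pi"
        using that t by (simp add: divide_le_eq)
      then show "\<alpha> + 2 * pi * real j / real t \<le> pi" using assms(14) by simp
    qed
    then show ?thesis by (auto simp del: upt_Suc)
  qed
  ultimately have \<xi>: "is_design ?\<xi>"
    using assms(9,10) t by (intro is_design_product pmf_of_list_wf_zip_map) (auto intro: less_imp_le)
  have one: "info_mat d ?\<xi> = 1\<^sub>m ((d + 1)\<^sup>2)"
    using assms(8-12) by (intro info_mat_product_design) (auto intro: less_imp_le)
  \<comment> \<open>Degree \<open>k q\<close> alone contributes 2 k q + 1 columns, so the spectrum
    of \<open>C_K\<close> is not empty.\<close>
  have "k q \<in> {..d} \<inter> k ` {0..q}" using assms(4) by simp
  then have "length (sel_positions d (k ` {0..q})) > 0"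
    unfolding length_sel_positions by (subst sum_pos2[of _ "k q"]) auto
  then have "Phi_optimal d p (selection_mat d (k ` {0..q})) ?\<xi>"
    using optimal_of_info_mat_one(1)[OF \<xi> one assms(2)] by auto
  moreover have "\<forall>r'. 1 \<le> r' \<and> r' \<le> (d+1)\<^sup>2 \<longrightarrow> Psi_optimal d p r' ?\<xi>"
    using optimal_of_info_mat_one(2)[OF \<xi> one assms(2)] by blast
  ultimately show ?thesis unfolding Let_def u by blast
qed

end
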